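(* If $C=p_r\dots p_s$ is a configuration of g-2PATH of Type II having free left hand and $-r\ge s$, then $\mathrm{mft}_{\text{g-2PATH}}(C)=-2r+s$.
   Context: Positions are elements of $\mathbb{Z}^2$; with $\epsilon_0=(1,0),\epsilon_1=(0,1),\epsilon_2=(-1,0),\epsilon_3=(0,-1)$, positions $p,p'$ are adjacent if $p'-p$ is some $\epsilon_i$. A configuration of g-2PATH is a sequence $C=p_r\dots p_s$ ($r\le0\le s$) of positions with $p_0=(0,0)$ (the general), consecutive positions adjacent, all positions distinct, and $p_l,p_m$ not adjacent whenever $|l-m|\ge2$. For $p\in C$, $\mathrm{bc}_C(p)=(b_0,\dots,b_3)$ with $b_i=1$ iff $p+\epsilon_i\in C$. Firing squad model (boundary-sensitive): a finite automaton $A$ has a finite state set with quiescent state $\mathrm{Q}$, general states $\mathrm{G}_0,\dots,\mathrm{G}_{m-1}$, firing states $\mathcal F\not\ni\mathrm{Q}$, a map $\tau:\{0,1\}^4\to\{0,\dots,m-1\}$ and a transition function from the current state and the four neighbour states ($\#$ where no node), with $\mathrm{Q}$ stable when all inputs are in $\{\mathrm{Q},\#\}$. On $C$, at time $0$ node $(0,0)$ is in $\mathrm{G}_{\tau(\mathrm{bc}_C((0,0)))}$, others in $\mathrm{Q}$, synchronous updates. $A$ is a solution of g-2PATH if for every configuration $C$ there is $t_C$ with no node in $\mathcal F$ before $t_C$ and all nodes in $\mathcal F$ at $t_C=:\mathrm{ft}(C,A)$. $\mathrm{mft}_{\text{g-2PATH}}(C)=\min_A\mathrm{ft}(C,A)$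 over solutions. For $r\le i\le0\le j\le s$, $W(i,j)$ is the set of pairs $(x_0,x_1)$ of finite, possibly empty, sequences of positions such that $x_0p_i\dots p_jx_1$ is a configuration $C'$ of g-2PATH (general at $p_0$) with $\mathrm{bc}_{C'}(p_l)=\mathrm{bc}_C(p_l)$ for $i\le l\le j$; $f(i,j)=\sup\{|x_0|:(x_0,x_1)\in W(i,j)\}$, $g(i,j)=\sup\{|x_1|:(x_0,x_1)\in W(i,j)\}$ (possibly $\infty$). The left hand of $C$ is free if $r=0$ or ($r<0$ and $f(r+1,s)=\infty$), and closed otherwise; the right hand is free if $s=0$ or ($s>0$ and $g(r,s-1)=\infty$), and closed otherwise. $C$ is of Type II if exactly one of its hands is free. *)

theory Defs
  imports Main "HOL-Library.Extended_Nat"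
begin

type_synonym pos = "int \<times> int"

definition padd :: "pos \<Rightarrow> pos \<Rightarrow> pos" where
  "padd a b = (fst a + fst b, snd a + snd b)"

definition eps :: "nat \<Rightarrow> pos" where
  "eps i = (if i = 0 then (1,0) else if i = 1 then (0,1) else if i = 2 then (-1,0) else (0,-1))"

definition adjacent :: "pos \<Rightarrow> pos \<Rightarrow> bool" where
  "adjacent a b \<longleftrightarrow> (\<exists>i<4. b = padd a (eps i))"

text \<open>A finite sequence of positions (as a list) is a configuration of g-2PATH
  whose general sits at list index k.\<close>
definition config_list :: "pos list \<Rightarrow> nat \<Rightarrow> bool" where
  "config_list cs k \<longleftrightarrow>
     k < length cs \<and> cs ! k = (0,0) \<and>
     (\<forall>l. l + 1 < length cs \<longrightarrow> adjacent (cs ! l) (cs ! (l+1))) \<and>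
     distinct cs \<and>
     (\<forall>l m. l < length cs \<and> m < length cs \<and> l + 2 \<le> m \<longrightarrow> \<not> adjacent (cs ! l) (cs ! m))"

definition is_config :: "int \<Rightarrow> int \<Rightarrow> (int \<Rightarrow> pos) \<Rightarrow> bool" where
  "is_config r s p \<longleftrightarrow> r \<le> 0 \<and> 0 \<le> s \<and> config_list (map p [r..s]) (nat (-r))"

definition nodes :: "int \<Rightarrow> int \<Rightarrow> (int \<Rightarrow> pos) \<Rightarrow> pos set" where
  "nodes r s p = p ` {r..s}"

type_synonym bcond = "bool \<times> bool \<times> bool \<times> bool"

definition bc :: "pos set \<Rightarrow> pos \<Rightarrow> bcond" where
  "bc S q = (padd q (eps 0) \<in> S, padd q (eps 1) \<in> S, padd q (eps 2) \<in> S, padd q (eps 3) \<in> S)"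

text \<open>States are natural numbers drawn from a finite state set; None plays the role of #.
  The transition takes the current state and the neighbour states in directions
  eps 0, eps 1, eps 2, eps 3.\<close>
record fsa =
  states :: "nat set"
  quiescent :: nat
  ngen :: nat
  gen :: "nat \<Rightarrow> nat"
  firing :: "nat set"
  tau :: "bcond \<Rightarrow> nat"
  delta :: "nat \<Rightarrow> nat option \<Rightarrow> nat option \<Rightarrow> nat option \<Rightarrow> nat option \<Rightarrow> nat"

definition wf_fsa :: "fsa \<Rightarrow> bool" where
  "wf_fsa A \<longleftrightarrow>
     finite (states A) \<and> quiescent A \<in> states A \<and>
     (\<forall>i < ngen A. gen A i \<in> states A) \<and>
     firing A \<subseteq> states A \<and> quiescent A \<notin> firing A \<and>
     (\<forall>b. tau A b < ngen A) \<and>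
     (\<forall>x a b c d. x \<in> states A \<and>
        (\<forall>y. a = Some y \<longrightarrow> y \<in> states A) \<and> (\<forall>y. b = Some y \<longrightarrow> y \<in> states A) \<and>
        (\<forall>y. c = Some y \<longrightarrow> y \<in> states A) \<and> (\<forall>y. d = Some y \<longrightarrow> y \<in> states A)
        \<longrightarrow> delta A x a b c d \<in> states A) \<and>
     (\<forall>a b c d. a \<in> {Some (quiescent A), None} \<and> b \<in> {Some (quiescent A), None} \<and>
        c \<in> {Some (quiescent A), None} \<and> d \<in> {Some (quiescent A), None}
        \<longrightarrow> delta A (quiescent A) a b c d = quiescent A)"

definition nbr :: "pos set \<Rightarrow> (pos \<Rightarrow> nat) \<Rightarrow> pos \<Rightarrow> nat \<Rightarrow> nat option" where
  "nbr S st q i = (if padd q (eps i) \<in> S then Some (st (padd q (eps i))) else None)"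

primrec run :: "fsa \<Rightarrow> pos set \<Rightarrow> nat \<Rightarrow> pos \<Rightarrow> nat" where
  "run A S 0 q = (if q = (0,0) then gen A (tau A (bc S (0,0))) else quiescent A)"
| "run A S (Suc t) q =
     delta A (run A S t q) (nbr S (run A S t) q 0) (nbr S (run A S t) q 1)
             (nbr S (run A S t) q 2) (nbr S (run A S t) q 3)"

definition fires_at :: "fsa \<Rightarrow> pos set \<Rightarrow> nat \<Rightarrow> bool" where
  "fires_at A S t \<longleftrightarrow>
     (\<forall>t' < t. \<forall>q \<in> S. run A S t' q \<notin> firing A) \<and> (\<forall>q \<in> S. run A S t q \<in> firing A)"

definition is_solution :: "fsa \<Rightarrow> bool" where
  "is_solution A \<longleftrightarrow> wf_fsa A \<and>
     (\<forall>r s p. is_config r s p \<longrightarrow> (\<exists>t. fires_at A (nodes r s p) t))"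

definition ft :: "int \<Rightarrow> int \<Rightarrow> (int \<Rightarrow> pos) \<Rightarrow> fsa \<Rightarrow> nat" where
  "ft r s p A = (THE t. fires_at A (nodes r s p) t)"

definition mft :: "int \<Rightarrow> int \<Rightarrow> (int \<Rightarrow> pos) \<Rightarrow> nat" where
  "mft r s p = (LEAST n. \<exists>A. is_solution A \<and> ft r s p A = n)"

definition W :: "int \<Rightarrow> int \<Rightarrow> (int \<Rightarrow> pos) \<Rightarrow> int \<Rightarrow> int \<Rightarrow> (pos list \<times> pos list) set" where
  "W r s p i j = {(x0, x1).
     config_list (x0 @ map p [i..j] @ x1) (length x0 + nat (-i)) \<and>
     (\<forall>l \<in> {i..j}. bc (set (x0 @ map p [i..j] @ x1)) (p l) = bc (nodes r s p) (p l))}"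

definition fW :: "int \<Rightarrow> int \<Rightarrow> (int \<Rightarrow> pos) \<Rightarrow> int \<Rightarrow> int \<Rightarrow> enat" where
  "fW r s p i j = Sup ((\<lambda>(x0, x1). enat (length x0)) ` W r s p i j)"

definition gW :: "int \<Rightarrow> int \<Rightarrow> (int \<Rightarrow> pos) \<Rightarrow> int \<Rightarrow> int \<Rightarrow> enat" where
  "gW r s p i j = Sup ((\<lambda>(x0, x1). enat (length x1)) ` W r s p i j)"

definition left_free :: "int \<Rightarrow> int \<Rightarrow> (int \<Rightarrow> pos) \<Rightarrow> bool" where
  "left_free r s p \<longleftrightarrow> r = 0 \<or> (r < 0 \<and> fW r s p (r+1) s = \<infinity>)"

definition right_free :: "int \<Rightarrow> int \<Rightarrow> (int \<Rightarrow> pos) \<Rightarrow> bool" where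
  "right_free r s p \<longleftrightarrow> s = 0 \<or> (s > 0 \<and> gW r s p r (s-1) = \<infinity>)"

definition type_II :: "int \<Rightarrow> int \<Rightarrow> (int \<Rightarrow> pos) \<Rightarrow> bool" where
  "type_II r s p \<longleftrightarrow> (left_free r s p \<noteq> right_free r s p)"

end

theory Submission
  imports Defs
begin

text \<open>
  Lower bound. As the left hand is free, \<open>p\<^bsub>r+1\<^esub> \<dots> p\<^sub>s\<close> extends, with unchanged
  boundary conditions, to a configuration whose left end is arbitrarily far away. What happens at
  \<open>p\<^sub>r\<close> cannot influence \<open>p\<^sub>s\<close> before time \<open>-r + (s - r) = -2r + s\<close>, so if \<open>p\<^sub>s\<close> fired earlier it would
  also fire in the extension, at a moment when the far left end is still quiescent.

  Upper bound. Fix any solution and run alongside it an automaton in which every node collects the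
  positions of \<open>C\<close> whose boundary conditions have been verified, together with a clock. At
  time \<open>T = -2r + s\<close> each node has heard from both ends (this uses \<open>-r \<ge> s\<close>), hence knows whether
  the configuration is exactly \<open>C\<close>, and in that case it fires.

  This needs some solution to begin with, of any speed. Here a scout walks from the general to one
  end, turns it into a wall and goes back to the other end, which becomes a wall that starts the
  synchronisation. Between two walls a single head
  bounces to and fro, each time shortening the block of unvisited cells by one, until it has found
  the middle; there one or two new walls appear, which start the same process in both
  halves. The halves have equal lengths, so all of them finish simultaneously, and a cell fires once
  it and its neighbours are walls.
\<close>

subsection \<open>Automata over arbitrary state types\<close>

definition sees :: "pos set \<Rightarrow> (pos \<Rightarrow> 'a) \<Rightarrow> pos \<Rightarrow> nat \<Rightarrow> 'a option" where
  "sees S st q d = (if padd q (eps d) \<in> S then Some (st (padd q (eps d))) else None)"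

text \<open>\<open>ini\<close> does the work of \<open>gen\<close> and \<open>tau\<close> together:
  there are only sixteen boundary conditions, and each may have a general state of its own. With an
  arbitrary state type, datatypes and products can serve as states.\<close>

locale automaton =
  fixes Q :: 'a and ini :: "bcond \<Rightarrow> 'a"
    and dl :: "'a \<Rightarrow> 'a option \<Rightarrow> 'a option \<Rightarrow> 'a option \<Rightarrow> 'a option \<Rightarrow> 'a"
    and \<Sigma> Fs :: "'a set"
  assumes finite_states: "finite \<Sigma>"
    and quiescent_state: "Q \<in> \<Sigma>" and initial_state: "\<And>b. ini b \<in> \<Sigma>"
    and firing_states: "Fs \<subseteq> \<Sigma>" "Q \<notin> Fs"
    and closed: "\<And>x a b c d. x \<in> \<Sigma> \<Longrightarrow> set_option a \<union> set_option b \<union> set_option c \<union> set_option d \<subseteq> \<Sigma>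
      \<Longrightarrow> dl x a b c d \<in> \<Sigma>"
    and quiet: "\<And>a b c d. {a, b, c, d} \<subseteq> {Some Q, None} \<Longrightarrow> dl Q a b c d = Q"
begin

primrec arun :: "pos set \<Rightarrow> nat \<Rightarrow> pos \<Rightarrow> 'a" where
  "arun S 0 q = (if q = (0,0) then ini (bc S (0,0)) else Q)"
| "arun S (Suc t) q = dl (arun S t q) (sees S (arun S t) q 0) (sees S (arun S t) q 1)
     (sees S (arun S t) q 2) (sees S (arun S t) q 3)"

definition afires :: "pos set \<Rightarrow> nat \<Rightarrow> bool" where
  "afires S t \<longleftrightarrow> (\<forall>t'<t. \<forall>q\<in>S. arun S t' q \<notin> Fs) \<and> (\<forall>q\<in>S. arun S t q \<in> Fs)"

lemma arun_state: "arun S t q \<in> \<Sigma>"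
proof (induction t arbitrary: q)
  case 0
  then show ?case using quiescent_state initial_state by simp
next
  case (Suc t)
  have "set_option (sees S (arun S t) q d) \<subseteq> \<Sigma>" for d using Suc by (auto simp: sees_def)
  then show ?case using Suc by (simp add: closed)
qed

text \<open>The finite set \<open>\<Sigma>\<close> is numbered injectively, and the new transition
  decodes, applies \<open>dl\<close> and encodes again. Decoding is correct on
  \<open>\<Sigma>\<close>, which a run never leaves.\<close>

lemma realise: "\<exists>A. wf_fsa A \<and> (\<forall>S t. fires_at A S t \<longleftrightarrow> afires S t)"
proof -
  obtain enc :: "'a \<Rightarrow> nat" where enc: "inj_on enc \<Sigma>"
    using finite_imp_inj_to_nat_seg[OF finite_states] by blast
  \<comment> \<open>An initial segment of the naturals as range keeps every value of
    \<open>tau\<close> below \<open>ngen\<close>.\<close>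
  obtain encb :: "bcond \<Rightarrow> nat" and m where encb: "inj encb" "range encb = {i. i < m}"
    using finite_imp_inj_to_nat_seg[of "UNIV :: bcond set"] by auto
  define dec where "dec = inv_into \<Sigma> enc"
  have dec: "dec (enc x) = x" if "x \<in> \<Sigma>" for x
    using enc that by (simp add: dec_def)
  define A where "A = \<lparr>states = enc ` \<Sigma>, quiescent = enc Q, ngen = m, gen = \<lambda>i. enc (ini (inv encb i)),
    firing = enc ` Fs, tau = encb,
    delta = \<lambda>x a b c d. enc (dl (dec x) (map_option dec a) (map_option dec b)
      (map_option dec c) (map_option dec d))\<rparr>"
  have mem: "map_option dec a \<in> {Some Q, None}" if "a \<in> {Some (enc Q), None}" for a
    using that dec quiescent_state by auto
  have cl: "set_option (map_option dec a) \<subseteq> \<Sigma>" if "\<forall>y. a = Some y \<longrightarrow> y \<in> enc ` \<Sigma>" for a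
    using that dec by auto
  have "wf_fsa A"
    unfolding wf_fsa_def
  proof (intro conjI allI impI)
    show "finite (states A)" "quiescent A \<in> states A" "firing A \<subseteq> states A"
      using finite_states quiescent_state firing_states by (auto simp: A_def)
    show "quiescent A \<notin> firing A"
      using enc quiescent_state firing_states by (auto simp: A_def inj_on_def)
    show "gen A i \<in> states A" for i using initial_state by (simp add: A_def)
    show "tau A b < ngen A" for b using encb by (auto simp: A_def)
    show "delta A x a b c d \<in> states A" if "x \<in> states A \<and>
        (\<forall>y. a = Some y \<longrightarrow> y \<in> states A) \<and> (\<forall>y. b = Some y \<longrightarrow> y \<in> states A) \<and>
        (\<forall>y. c = Some y \<longrightarrow> y \<in> states A) \<and> (\<forall>y. d = Some y \<longrightarrow> y \<in> states A)" for x a b c d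
    proof -
      have "dec x \<in> \<Sigma>" using that dec by (auto simp: A_def)
      then show ?thesis
        using that cl[of a] cl[of b] cl[of c] cl[of d] closed[of "dec x"] by (simp add: A_def)
    qed
    show "delta A (quiescent A) a b c d = quiescent A"
      if "a \<in> {Some (quiescent A), None} \<and> b \<in> {Some (quiescent A), None} \<and>
        c \<in> {Some (quiescent A), None} \<and> d \<in> {Some (quiescent A), None}" for a b c d
      using that mem[of a] mem[of b] mem[of c] mem[of d] dec[OF quiescent_state]
      by (simp add: A_def quiet)
  qed
  moreover have run: "run A S t q = enc (arun S t q)" for S t q
  proof (induction t arbitrary: q)
    case 0
    then show ?case using encb by (simp add: A_def)
  next
    case (Suc t)
    have "map_option dec (nbr S (run A S t) q d) = sees S (arun S t) q d" for d
      using Suc dec arun_state by (simp add: nbr_def sees_def)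
    moreover have "dec (run A S t q) = arun S t q" using Suc dec arun_state by simp
    ultimately show ?case by (simp add: A_def)
  qed
  have "run A S t q \<in> firing A \<longleftrightarrow> arun S t q \<in> Fs" for S t q
    using enc firing_states arun_state[of S t q] inj_on_image_mem_iff[OF enc]
    unfolding run by (simp add: A_def)
  ultimately show ?thesis
    unfolding fires_at_def afires_def by blast
qed

end

subsection \<open>Paths in the grid\<close>

lemma ex_less_4: "(\<exists>i<4. P i) \<longleftrightarrow> P 0 \<or> P 1 \<or> P 2 \<or> P (3 :: nat)"
proof -
  have "{..<4} = {0, 1, 2, 3 :: nat}" by auto
  then show ?thesis
    by (metis (no_types, lifting) insertE insertI1 insertI2 lessThan_iff singletonD)
qed

text \<open>Beyond \<open>d = 3\<close> the last branch of \<open>eps\<close> applies, so every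
  \<open>eps d\<close> is one of the four directions.\<close>

lemma adjacent_eps: "adjacent q (padd q (eps d))"
  unfolding adjacent_def
  by (cases "d < 4") (auto simp: eps_def intro: exI[of _ 3])

lemma adjacent_diff:
  "adjacent a b \<longleftrightarrow> (fst b - fst a, snd b - snd a) \<in> {(1,0), (0,1), (-1,0), (0,-1)}"
  unfolding adjacent_def ex_less_4 by (cases a; cases b) (auto simp: padd_def eps_def)

lemma adjacent_sym: "adjacent a b \<Longrightarrow> adjacent b a"
  by (auto simp: adjacent_diff)

text \<open>Integer indices replace list positions, and the two adjacency clauses of
  \<open>config_list\<close> merge into one equivalence symmetric in its indices, which makes
  reversing a path easy.\<close>

definition path :: "int \<Rightarrow> int \<Rightarrow> (int \<Rightarrow> pos) \<Rightarrow> bool" where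
  "path r s p \<longleftrightarrow> r \<le> 0 \<and> 0 \<le> s \<and> p 0 = (0,0) \<and> inj_on p {r..s} \<and>
     (\<forall>i\<in>{r..s}. \<forall>j\<in>{r..s}. adjacent (p i) (p j) \<longleftrightarrow> \<bar>i - j\<bar> = 1)"

lemma adjacent_irrefl: "\<not> adjacent a a"
  by (simp add: adjacent_diff)

lemma is_config_iff_path: "is_config r s p \<longleftrightarrow> path r s p"
proof (cases "r \<le> 0 \<and> 0 \<le> s")
  case True
  define cs n where "cs = map p [r..s]" and "n = length cs"
  have nth: "cs ! l = p (r + int l)" if "l < n" for l
    using that by (simp add: nth_upto cs_def n_def)
  have less: "l < n \<longleftrightarrow> r + int l \<le> s" for l
    using True by (auto simp: cs_def n_def)
  \<comment> \<open>Quantifiers over list positions become quantifiers over \<open>{r..s}\<close>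
    through the shift \<open>i = r + int l\<close>.\<close>
  have all: "(\<forall>l < n. P (r + int l)) \<longleftrightarrow> (\<forall>i\<in>{r..s}. P i)" for P
  proof
    assume *: "\<forall>l < n. P (r + int l)"
    show "\<forall>i\<in>{r..s}. P i"
    proof
      fix i assume "i \<in> {r..s}"
      then show "P i" using *[rule_format, of "nat (i - r)"] less by simp
    qed
  qed (simp add: less)
  have dist: "distinct cs \<longleftrightarrow> inj_on p {r..s}" by (simp add: cs_def distinct_map)
  have gen: "nat (- r) < n \<and> cs ! nat (- r) = (0,0) \<longleftrightarrow> p 0 = (0,0)"
    using True less[of "nat (- r)"] nth[of "nat (- r)"] by simp
  have step: "(\<forall>l. l + 1 < n \<longrightarrow> adjacent (cs ! l) (cs ! (l + 1))) \<longleftrightarrow>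
      (\<forall>l<n. r + int l < s \<longrightarrow> adjacent (p (r + int l)) (p (r + int l + 1)))"
  proof -
    have "l + 1 < n \<longleftrightarrow> l < n \<and> r + int l < s" for l using less[of l] less[of "l + 1"] by auto
    moreover have "cs ! (l + 1) = p (r + int l + 1)" if "l + 1 < n" for l
      using nth[OF that] by (simp add: ac_simps)
    ultimately show ?thesis using nth by metis
  qed
  have far: "(\<forall>l m. l < n \<and> m < n \<and> l + 2 \<le> m \<longrightarrow> \<not> adjacent (cs ! l) (cs ! m)) \<longleftrightarrow>
      (\<forall>l<n. \<forall>m<n. r + int l + 2 \<le> r + int m \<longrightarrow> \<not> adjacent (p (r + int l)) (p (r + int m)))"
  proof -
    have "l + 2 \<le> m \<longleftrightarrow> r + int l + 2 \<le> r + int m" for l m by linarith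
    then show ?thesis using nth by metis
  qed
  have "is_config r s p \<longleftrightarrow> p 0 = (0,0) \<and>
      (\<forall>i\<in>{r..s}. i < s \<longrightarrow> adjacent (p i) (p (i + 1))) \<and> inj_on p {r..s} \<and>
      (\<forall>i\<in>{r..s}. \<forall>j\<in>{r..s}. i + 2 \<le> j \<longrightarrow> \<not> adjacent (p i) (p j))"
    unfolding all[of "\<lambda>i. i < s \<longrightarrow> adjacent (p i) (p (i + 1))", symmetric]
      all[of "\<lambda>i. \<forall>j\<in>{r..s}. i + 2 \<le> j \<longrightarrow> \<not> adjacent (p i) (p j)", symmetric]
      all[of "\<lambda>j. r + int l + 2 \<le> j \<longrightarrow> \<not> adjacent (p (r + int l)) (p j)" for l, symmetric]
    using True unfolding is_config_def config_list_def cs_def[symmetric] n_def[symmetric]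
    using gen step far dist by blast
  also have "\<dots> \<longleftrightarrow> path r s p"
  proof
    assume *: "p 0 = (0,0) \<and>
      (\<forall>i\<in>{r..s}. i < s \<longrightarrow> adjacent (p i) (p (i + 1))) \<and> inj_on p {r..s} \<and>
      (\<forall>i\<in>{r..s}. \<forall>j\<in>{r..s}. i + 2 \<le> j \<longrightarrow> \<not> adjacent (p i) (p j))"
    have "adjacent (p i) (p j) \<longleftrightarrow> \<bar>i - j\<bar> = 1" if "i \<in> {r..s}" "j \<in> {r..s}" for i j
    proof -
      consider "i = j" | "j = i + 1" | "i = j + 1" | "i + 2 \<le> j" | "j + 2 \<le> i" by linarith
      then show ?thesis
        using that * adjacent_sym[of "p i" "p j"] adjacent_sym[of "p j" "p i"]
        by cases (auto simp: adjacent_irrefl)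
    qed
    then show "path r s p" using * True by (simp add: path_def)
  next
    assume "path r s p"
    then show "p 0 = (0,0) \<and>
      (\<forall>i\<in>{r..s}. i < s \<longrightarrow> adjacent (p i) (p (i + 1))) \<and> inj_on p {r..s} \<and>
      (\<forall>i\<in>{r..s}. \<forall>j\<in>{r..s}. i + 2 \<le> j \<longrightarrow> \<not> adjacent (p i) (p j))"
      by (auto simp: path_def)
  qed
  finally show ?thesis .
qed (auto simp: is_config_def path_def)

definition nbrs :: "pos set \<Rightarrow> pos \<Rightarrow> pos set" where
  "nbrs S q = {v \<in> S. adjacent q v}"

text \<open>A configuration never touches itself, so the grid neighbours of a node are its
  neighbours along the path and an automaton runs as on a line.\<close>

lemma path_nbrs:
  assumes "path r s p" "i \<in> {r..s}"
  shows "nbrs (nodes r s p) (p i) = p ` ({i - 1, i + 1} \<inter> {r..s})"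
  using assms by (auto simp: nbrs_def nodes_def path_def)

lemma path_reverse:
  assumes "path r s p"
  shows "path (- s) (- r) (\<lambda>i. p (- i))" "nodes (- s) (- r) (\<lambda>i. p (- i)) = nodes r s p"
proof -
  have "inj_on (\<lambda>i. p (- i)) {- s..- r}"
    using assms inj_onD[of p "{r..s}" "- i" "- j" for i j] by (intro inj_onI) (simp add: path_def)
  then show "path (- s) (- r) (\<lambda>i. p (- i))"
    using assms by (simp add: path_def abs_minus_commute add.commute)
  have "p i \<in> (\<lambda>i. p (- i)) ` {- s..- r}" if "i \<in> {r..s}" for i
    using that by (intro image_eqI[of _ _ "- i"]) auto
  then show "nodes (- s) (- r) (\<lambda>i. p (- i)) = nodes r s p"
    by (auto simp: nodes_def)
qed

subsection \<open>Halving a segment\<close>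

text \<open>A round of the synchronisation has a colour \<open>c\<close>. Unvisited cells are \<open>Blank c\<close>, and the head
  leaves cells of the opposite colour behind when the block shrinks, so that they are the unvisited
  cells of the next round. The flag of \<open>Head\<close> and \<open>Kick\<close> tells whether the head is moving
  towards the wall it came from. \<open>Far c\<close> marks the latest cell given up at the far side: if the block
  shrinks to one cell while the head is moving home, that cell and its neighbour \<open>Far c\<close> are the two middles.
  The quiescent state is \<open>Blank False\<close>.\<close>

datatype cell = Blank bool | Head bool bool | Tail bool | Kick bool bool | Far bool
  | Gen bool | Wall | Fire | Init nat | Scout bool | Trail | Bounce

definition wall :: "cell \<Rightarrow> bool" where
  "wall x \<longleftrightarrow> x = Wall \<or> x \<in> range Gen"

text \<open>A moving head leaves \<open>Tail\<close> behind for one step, so that the cell it has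
  just left is not blank and cannot catch the head again; \<open>Trail\<close> does the same for a
  scout. At an end of the block the head becomes \<open>Kick\<close>, whose flag keeps the direction
  of arrival: a blank neighbour then becomes a head going the other way, and if there is none, the
  middle has been found.\<close>

fun cstep :: "cell \<Rightarrow> cell set \<Rightarrow> cell" where
  "cstep (Blank c) N =
     (if Gen c \<in> N \<or> Head c False \<in> N \<or> Kick c True \<in> N then Head c False
      else if Head c True \<in> N \<or> Kick c False \<in> N then Head c True
      else if c then Blank c
      else if Scout False \<in> N then Scout False
      else if Scout True \<in> N \<or> Bounce \<in> N then Scout True
      else Blank c)"
| "cstep (Head c e) N = (if Blank c \<in> N then Tail c else Kick c e)"
| "cstep (Tail c) N = Blank c"
| "cstep (Kick c e) N =
     (if Blank c \<in> N then (if e then Blank (\<not> c) else Far c) else Gen (\<not> c))"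
| "cstep (Far c) N =
     (if Kick c False \<in> N then Blank (\<not> c) else if Kick c True \<in> N then Gen (\<not> c) else Far c)"
| "cstep (Gen c) N = (if \<forall>x\<in>N. wall x then Fire else Wall)"
| "cstep Wall N = (if \<forall>x\<in>N. wall x then Fire else Wall)"
| "cstep Fire N = Fire"
| "cstep (Init d) N = Trail"
| "cstep (Scout e) N = (if Blank False \<in> N then Trail else if e then Gen False else Bounce)"
| "cstep Trail N = Blank False"
| "cstep Bounce N = Wall"

text \<open>A model of a segment between two fixed walls, in which the moves of the head are
  computed before being transferred to a run.\<close>

fun sstep :: "nat \<Rightarrow> (nat \<Rightarrow> cell) \<Rightarrow> nat \<Rightarrow> cell" where
  "sstep n f 0 = Wall"
| "sstep n f (Suc j) = (if j < n then cstep (f (Suc j)) {f j, f (Suc (Suc j))} else Wall)"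

lemma sstep_eqI:
  assumes "g 0 = Wall" "\<And>j. n \<le> j \<Longrightarrow> g (Suc j) = Wall"
    and "\<And>j. j < n \<Longrightarrow> cstep (f (Suc j)) {f j, f (Suc (Suc j))} = g (Suc j)"
  shows "sstep n f = g"
proof
  show "sstep n f i = g i" for i using assms by (cases i) auto
qed

text \<open>The remaining block is \<open>a..b\<close>. Walls are tested first, so for
  \<open>b = n\<close> the cell beyond the block is the wall and there is no
  \<open>Far\<close>.\<close>

definition block :: "bool \<Rightarrow> nat \<Rightarrow> nat \<Rightarrow> nat \<Rightarrow> nat \<Rightarrow> cell" where
  "block c n a b i = (if i = 0 \<or> n < i then Wall else if i < a \<or> b + 1 < i then Blank (\<not> c)
     else if i = b + 1 then Far c else Blank c)"

definition outw :: "bool \<Rightarrow> nat \<Rightarrow> nat \<Rightarrow> nat \<Rightarrow> nat \<Rightarrow> nat \<Rightarrow> cell" where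
  "outw c n a b h i = (if i = h then Head c False else if i + 1 = h \<and> a \<le> i then Tail c
     else block c n a b i)"

definition homew :: "bool \<Rightarrow> nat \<Rightarrow> nat \<Rightarrow> nat \<Rightarrow> nat \<Rightarrow> nat \<Rightarrow> cell" where
  "homew c n a b h i = (if i = h then Head c True else if i = h + 1 \<and> i \<le> b then Tail c
     else block c n a b i)"

section \<open>Moves of the head and the halving of a block\<close>

lemma outw_move:
  assumes "1 \<le> a" "a \<le> h" "h < b" "b \<le> n"
  shows "sstep n (outw c n a b h) = outw c n a b (h + 1)" (is "sstep n ?f = ?g")
proof (rule sstep_eqI)
  fix j assume "j < n"
  \<comment> \<open>The cases locate the cell \<open>j + 1\<close> relative to the head and the ends
    of the block; in each of them \<open>cstep\<close> can be evaluated.\<close>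
  consider "j + 1 < a" | "a \<le> j + 1" "j + 1 < h" | "h = j + 1" | "h = j" | "h < j" "j < b" | "b = j" | "b < j"
    using assms by linarith
  then show "cstep (?f (Suc j)) {?f j, ?f (Suc (Suc j))} = ?g (Suc j)"
    using assms \<open>j < n\<close> by cases (simp_all add: outw_def block_def)
qed (use assms in \<open>simp_all add: outw_def block_def\<close>)

lemma outw_kick:
  assumes "1 \<le> a" "a \<le> b" "b \<le> n"
  shows "sstep n (outw c n a b b) = (block c n a b)(b := Kick c False)" (is "sstep n ?f = ?g")
proof (rule sstep_eqI)
  fix j assume "j < n"
  consider "j + 1 < a" | "a \<le> j + 1" "j + 1 < b" | "b = j + 1" | "b = j" | "b < j"
    using assms by linarith
  then show "cstep (?f (Suc j)) {?f j, ?f (Suc (Suc j))} = ?g (Suc j)"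
    using assms \<open>j < n\<close> by cases (simp_all add: outw_def block_def)
qed (use assms in \<open>simp_all add: outw_def block_def\<close>)

text \<open>The far end gives up a cell: the \<open>Kick\<close> becomes the new \<open>Far\<close>,
  a former \<open>Far\<close> at \<open>b + 2\<close> turns into a cell of the next round, and the
  head starts home from \<open>b\<close>.\<close>

lemma outw_turn:
  assumes "1 \<le> a" "a \<le> b" "b < n"
  shows "sstep n ((block c n a (b + 1))(b + 1 := Kick c False)) = homew c n a b b" (is "sstep n ?f = ?g")
proof (rule sstep_eqI)
  fix j assume "j < n"
  consider "j + 1 < a" | "a \<le> j + 1" "j + 1 < b" | "b = j + 1" | "j = b" | "j = b + 1" | "b + 1 < j"
    using assms by linarith
  then show "cstep (?f (Suc j)) {?f j, ?f (Suc (Suc j))} = ?g (Suc j)"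
    using assms \<open>j < n\<close> by cases (simp_all add: homew_def block_def)
qed (use assms in \<open>simp_all add: homew_def block_def\<close>)

lemma homew_move:
  assumes "1 \<le> a" "a \<le> h" "h < b" "b < n"
  shows "sstep n (homew c n a b (h + 1)) = homew c n a b h" (is "sstep n ?f = ?g")
proof (rule sstep_eqI)
  fix j assume "j < n"
  consider "j + 1 < a" | "a \<le> j + 1" "j + 1 < h" | "h = j + 1" | "h = j" | "j = h + 1" "j < b" | "j = h + 1" "j = b" | "h + 1 < j" "j < b" | "h + 1 < j" "b = j" | "b < j"
    using assms by linarith
  then show "cstep (?f (Suc j)) {?f j, ?f (Suc (Suc j))} = ?g (Suc j)"
    using assms \<open>j < n\<close> by cases (simp_all add: homew_def block_def)
qed (use assms in \<open>simp_all add: homew_def block_def\<close>)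

lemma homew_kick:
  assumes "1 \<le> a" "a \<le> b" "b < n"
  shows "sstep n (homew c n a b a) = (block c n a b)(a := Kick c True)" (is "sstep n ?f = ?g")
proof (rule sstep_eqI)
  fix j assume "j < n"
  consider "j + 2 < a" | "a = j + 2" | "a = j + 1" | "a = j" "j < b" | "a = j" "j = b" | "a < j" "j < b" | "a < j" "b = j" | "b < j"
    using assms by linarith
  then show "cstep (?f (Suc j)) {?f j, ?f (Suc (Suc j))} = ?g (Suc j)"
    using assms \<open>j < n\<close> by cases (simp_all add: homew_def block_def)
qed (use assms in \<open>simp_all add: homew_def block_def\<close>)

lemma homew_turn:
  assumes "1 \<le> a" "a < b" "b < n"
  shows "sstep n ((block c n a b)(a := Kick c True)) = outw c n (a + 1) b (a + 1)" (is "sstep n ?f = ?g")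
proof (rule sstep_eqI)
  fix j assume "j < n"
  consider "j + 1 < a" | "a = j + 1" | "a = j" | "a < j" "j < b" | "b = j" | "b < j"
    using assms by linarith
  then show "cstep (?f (Suc j)) {?f j, ?f (Suc (Suc j))} = ?g (Suc j)"
    using assms \<open>j < n\<close> by cases (simp_all add: outw_def block_def)
qed (use assms in \<open>simp_all add: outw_def block_def\<close>)

definition halved :: "bool \<Rightarrow> nat \<Rightarrow> nat \<Rightarrow> nat \<Rightarrow> nat \<Rightarrow> cell" where
  "halved c n a b i = (if i = 0 \<or> n < i then Wall else if i = a \<or> i = b then Gen (\<not> c) else Blank (\<not> c))"

lemma outw_split:
  assumes "1 \<le> a" "a \<le> n"
  shows "sstep n ((block c n a a)(a := Kick c False)) = halved c n a a" (is "sstep n ?f = ?g")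
proof (rule sstep_eqI)
  fix j assume "j < n"
  consider "j + 1 < a" | "a = j + 1" | "a = j" | "a < j"
    using assms by linarith
  then show "cstep (?f (Suc j)) {?f j, ?f (Suc (Suc j))} = ?g (Suc j)"
    using assms \<open>j < n\<close> by cases (simp_all add: halved_def block_def)
qed (use assms in \<open>simp_all add: halved_def block_def\<close>)

text \<open>Two middles arise because the \<open>Far\<close> cell at \<open>a + 1\<close> sees the
  same \<open>Kick c True\<close>. In \<open>outw_split\<close> a \<open>Far\<close> cell would see
  \<open>Kick c False\<close> and turn blank, which leaves one middle.\<close>

lemma homew_split:
  assumes "1 \<le> a" "a < n"
  shows "sstep n ((block c n a a)(a := Kick c True)) = halved c n a (a + 1)" (is "sstep n ?f = ?g")
proof (rule sstep_eqI)
  fix j assume "j < n"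
  consider "j + 1 < a" | "a = j + 1" | "a = j" | "a < j"
    using assms by linarith
  then show "cstep (?f (Suc j)) {?f j, ?f (Suc (Suc j))} = ?g (Suc j)"
    using assms \<open>j < n\<close> by cases (simp_all add: halved_def block_def)
qed (use assms in \<open>simp_all add: halved_def block_def\<close>)

text \<open>A wall fires only when all its neighbours are walls. As long as the cells inside are not
  walls, the end walls therefore stay, and \<open>sstep\<close> is faithful to a run.\<close>

definition busy :: "nat \<Rightarrow> (nat \<Rightarrow> cell) \<Rightarrow> bool" where
  "busy n f \<longleftrightarrow> f 0 = Wall \<and> f (Suc n) = Wall \<and> (\<forall>i<n. \<not> wall (f (Suc i)) \<and> f (Suc i) \<noteq> Fire)"

text \<open>\<open>busy\<close> is asked before each step only, so a run may end in
  \<open>halved\<close>, which already has walls inside.\<close>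

inductive sreach :: "nat \<Rightarrow> nat \<Rightarrow> (nat \<Rightarrow> cell) \<Rightarrow> (nat \<Rightarrow> cell) \<Rightarrow> bool" for n where
  stop: "sreach n 0 f f"
| move: "busy n f \<Longrightarrow> sreach n d (sstep n f) g \<Longrightarrow> sreach n (Suc d) f g"

lemma busy_block:
  "1 \<le> h \<Longrightarrow> h \<le> n \<Longrightarrow> busy n ((block c n a b)(h := Kick c e))"
  by (auto simp: busy_def block_def wall_def)

lemma busy_head:
  assumes "1 \<le> h" "h \<le> n"
  shows "1 \<le> a \<Longrightarrow> busy n (outw c n a b h)" "b \<le> n \<Longrightarrow> busy n (homew c n a b h)"
  using assms by (auto simp: busy_def outw_def homew_def block_def wall_def)

text \<open>The induction goes backwards from the kick at \<open>b\<close>, because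
  \<open>move\<close> puts a step in front of a run.\<close>

lemma outw_reach:
  assumes "sreach n d ((block c n a b)(b := Kick c False)) g" "1 \<le> a" "a \<le> h" "h \<le> b" "b \<le> n"
  shows "\<exists>d. sreach n d (outw c n a b h) g"
  using assms(4,3)
proof (induction h rule: inc_induct)
  case base
  have "sreach n (Suc d) (outw c n a b b) g"
    using assms busy_head(1)[of b n a c b] outw_kick[of a b n c] by (intro sreach.move) auto
  then show ?case by blast
next
  case (step h)
  then obtain d' where "sreach n d' (outw c n a b (Suc h)) g" by auto
  then have "sreach n (Suc d') (outw c n a b h) g"
    using assms step busy_head(1)[of h n a c b] outw_move[of a h b n c] by (intro sreach.move) auto
  then show ?case by blast
qed

lemma homew_reach:
  assumes "sreach n d ((block c n a b)(a := Kick c True)) g" "1 \<le> a" "a \<le> h" "h \<le> b" "b < n"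
  shows "\<exists>d. sreach n d (homew c n a b h) g"
  using assms(3,4)
proof (induction h rule: dec_induct)
  case base
  have "sreach n (Suc d) (homew c n a b a) g"
    using assms busy_head(2)[of a n b c a] homew_kick[of a b n c] by (intro sreach.move) auto
  then show ?case by blast
next
  case (step h)
  then obtain d' where "sreach n d' (homew c n a b h) g" by auto
  then have "sreach n (Suc d') (homew c n a b (Suc h)) g"
    using assms step busy_head(2)[of "Suc h" n b c a] homew_move[of a h b n c]
    by (intro sreach.move) auto
  then show ?case by blast
qed

text \<open>A round trip takes one cell from each end, so \<open>a + b = n + 1\<close>, saying that
  the block is centred, is an invariant. The parity of \<open>n\<close> decides whether the last
  cell is met on the way out or on the way home.\<close>

lemma outw_halve:
  assumes "1 \<le> a" "a \<le> b" "a + b = n + 1"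
  shows "\<exists>d. sreach n d (outw c n a b a) (halved c n ((n + 1) div 2) (n div 2 + 1))"
  using assms
proof (induction "b - a" arbitrary: a b rule: less_induct)
  case less
  let ?g = "halved c n ((n + 1) div 2) (n div 2 + 1)"
  have b: "b \<le> n" using less.prems by linarith
  have "\<exists>d. sreach n d ((block c n a b)(b := Kick c False)) ?g"
  proof (cases "a = b")
    case True
    then have "(n + 1) div 2 = a" "n div 2 + 1 = a" using less.prems by linarith+
    then have "sreach n (Suc 0) ((block c n a b)(b := Kick c False)) ?g"
      using True less.prems b outw_split[of a n c]
      by (intro sreach.move busy_block) (auto intro: sreach.stop)
    then show ?thesis by blast
  next
    case False
    \<comment> \<open>The kick at the far end gives up the cell \<open>b\<close>. If only
      \<open>a\<close> is left after that, the head is already on its way home and two middles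
      arise.\<close>
    then obtain b' where b': "b = b' + 1" "a \<le> b'" using less.prems
      by (metis Suc_eq_plus1 le_eq_less_or_eq less_imp_Suc_add add_Suc_right le_add1)
    have "\<exists>d. sreach n d ((block c n a b')(a := Kick c True)) ?g"
    proof (cases "a = b'")
      case True
      then have "(n + 1) div 2 = a" "n div 2 + 1 = a + 1" using less.prems b' by linarith+
      then have "sreach n (Suc 0) ((block c n a b')(a := Kick c True)) ?g"
        using True less.prems b b' homew_split[of a n c]
        by (intro sreach.move busy_block) (auto intro: sreach.stop)
      then show ?thesis by blast
    next
      case False
      then obtain d where "sreach n d (outw c n (a + 1) b' (a + 1)) ?g"
        using less.hyps[of b' "a + 1"] less.prems b' by force
      then have "sreach n (Suc d) ((block c n a b')(a := Kick c True)) ?g"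
        using False less.prems b b' homew_turn[of a b' n c] by (intro sreach.move busy_block) auto
      then show ?thesis by blast
    qed
    then obtain d where "sreach n d (homew c n a b' b') ?g"
      using homew_reach[of n _ c a b' ?g b'] less.prems b b' by auto
    then have "sreach n (Suc d) ((block c n a b)(b := Kick c False)) ?g"
      using less.prems b b' outw_turn[of a b' n c] by (intro sreach.move busy_block) auto
    then show ?thesis by blast
  qed
  then show ?case using outw_reach[of n _ c a b ?g a] less.prems b by auto
qed

section \<open>Segments inside a larger graph\<close>

locale cell_run =
  fixes N :: "'v \<Rightarrow> 'v set" and st :: "nat \<Rightarrow> 'v \<Rightarrow> cell"
  assumes st_Suc: "st (Suc t) v = cstep (st t v) (st t ` N v)"
begin

text \<open>The end vertices may have further neighbours outside, so that a new wall in the middle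
  can bound a segment on either side.\<close>

definition segment :: "(nat \<Rightarrow> 'v) \<Rightarrow> nat \<Rightarrow> bool" where
  "segment \<phi> n \<longleftrightarrow> \<phi> 1 \<in> N (\<phi> 0) \<and> \<phi> n \<in> N (\<phi> (Suc n)) \<and>
     (\<forall>i<n. N (\<phi> (Suc i)) = {\<phi> i, \<phi> (Suc (Suc i))})"

definition displays :: "(nat \<Rightarrow> 'v) \<Rightarrow> nat \<Rightarrow> nat \<Rightarrow> (nat \<Rightarrow> cell) \<Rightarrow> bool" where
  "displays \<phi> n t f \<longleftrightarrow> (\<forall>i \<le> Suc n. st t (\<phi> i) = f i)"

definition settles :: "(nat \<Rightarrow> 'v) \<Rightarrow> nat \<Rightarrow> nat \<Rightarrow> nat \<Rightarrow> bool" where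
  "settles \<phi> n t E \<longleftrightarrow> (\<forall>u\<le>E. \<forall>i \<le> Suc n. st (t + u) (\<phi> i) \<noteq> Fire) \<and>
     (\<forall>i \<le> Suc n. wall (st (t + E) (\<phi> i)))"

definition primed :: "bool \<Rightarrow> (nat \<Rightarrow> 'v) \<Rightarrow> nat \<Rightarrow> nat \<Rightarrow> bool" where
  "primed c \<phi> n t \<longleftrightarrow> segment \<phi> n \<and> st t (\<phi> 0) = Gen c \<and> st t (\<phi> (Suc n)) = Wall \<and>
     (\<forall>i<n. st t (\<phi> (Suc i)) = Blank c)"

lemma wall_persists:
  assumes "wall (st t v)" "w \<in> N v" "\<not> wall (st t w)"
  shows "st (Suc t) v = Wall"
  using assms by (auto simp: st_Suc wall_def)

lemma segment_step:
  assumes "segment \<phi> n" "1 \<le> n" "displays \<phi> n t f" "busy n f"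
  shows "displays \<phi> n (Suc t) (sstep n f)"
  unfolding displays_def
proof (intro allI impI)
  fix i assume i: "i \<le> Suc n"
  have f: "st t (\<phi> j) = f j" if "j \<le> Suc n" for j
    using assms(3) that by (simp add: displays_def)
  consider "i = 0" | "i = Suc n" | j where "j < n" "i = Suc j"
    using i by (cases i) force+
  then show "st (Suc t) (\<phi> i) = sstep n f i"
  proof cases
    case 1
    then show ?thesis
      using wall_persists[of t "\<phi> 0" "\<phi> 1"] assms f[of 0] f[of 1]
      by (auto simp: segment_def busy_def wall_def)
  next
    case 2
    moreover obtain m where "n = Suc m" using \<open>1 \<le> n\<close> by (cases n) auto
    ultimately show ?thesis
      using wall_persists[of t "\<phi> (Suc n)" "\<phi> n"] assms f[of n] f[of "Suc n"]
      by (auto simp: segment_def busy_def wall_def)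
  next
    case 3
    then show ?thesis
      using assms f[of j] f[of "Suc j"] f[of "Suc (Suc j)"] by (simp add: st_Suc segment_def)
  qed
qed

lemma segment_reach:
  assumes "sreach n d f g" "segment \<phi> n" "1 \<le> n" "displays \<phi> n t f"
  shows "displays \<phi> n (t + d) g \<and> (\<forall>u<d. \<forall>i \<le> Suc n. st (t + u) (\<phi> i) \<noteq> Fire)"
  using assms(1,4)
proof (induction arbitrary: t)
  case stop
  then show ?case by simp
next
  case (move f d g)
  have IH: "displays \<phi> n (Suc t + d) g \<and> (\<forall>u<d. \<forall>i \<le> Suc n. st (Suc t + u) (\<phi> i) \<noteq> Fire)"
    using move segment_step assms(2,3) by blast
  have "st (t + u) (\<phi> i) \<noteq> Fire" if "u < Suc d" "i \<le> Suc n" for u i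
  proof (cases u)
    case 0
    have "st t (\<phi> i) = f i" using move.prems that by (simp add: displays_def)
    moreover have "i = 0 \<or> i = Suc n \<or> (\<exists>j<n. i = Suc j)" using that by (cases i) force+
    ultimately show ?thesis using move.hyps(1) 0 by (auto simp: busy_def)
  next
    case (Suc u')
    then show ?thesis using IH that by auto
  qed
  then show ?case using IH by simp
qed

text \<open>At the start \<open>\<phi> 0\<close> is a \<open>Gen\<close> and not yet a
  \<open>Wall\<close>, so this step lies outside the model. Only the cell next to the
  \<open>Gen\<close> wakes up.\<close>

lemma primed_step:
  assumes "primed c \<phi> n t" "1 \<le> n"
  shows "displays \<phi> n (Suc t) (outw c n 1 n 1)"
  unfolding displays_def
proof (intro allI impI)
  fix i assume i: "i \<le> Suc n"
  obtain m where m: "n = Suc m" using \<open>1 \<le> n\<close> by (cases n) auto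
  consider "i = 0" | "i = Suc n" | "i = 1" | j where "j < m" "i = Suc (Suc j)"
    using i m by (cases i; cases "i - 1") force+
  then show "st (Suc t) (\<phi> i) = outw c n 1 n 1 i"
  proof cases
    case 1
    then show ?thesis
      using wall_persists[of t "\<phi> 0" "\<phi> 1"] assms m
      by (auto simp: segment_def primed_def wall_def outw_def block_def)
  next
    case 2
    then show ?thesis
      using wall_persists[of t "\<phi> (Suc n)" "\<phi> n"] assms m
      by (auto simp: segment_def primed_def wall_def outw_def block_def)
  next
    case 3
    then show ?thesis
      using assms by (auto simp: segment_def primed_def st_Suc outw_def)
  next
    case 4
    have "st t (\<phi> (Suc j)) = Blank c" "st t (\<phi> (Suc (Suc j))) = Blank c"
      using assms 4 m by (simp_all add: primed_def)
    moreover have "st t (\<phi> (Suc (Suc (Suc j)))) \<in> {Blank c, Wall}"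
      using assms 4 m by (cases "Suc j = m") (auto simp: primed_def)
    ultimately show ?thesis using assms 4 m
      by (auto simp: segment_def primed_def st_Suc outw_def block_def)
  qed
qed

text \<open>The order of the quantifiers is the synchronisation: \<open>E\<close> depends only on
  colour and length. The two halves have equal length and are primed at the same moment with the
  opposite colour, so they settle together.\<close>

lemma segment_settles: "\<exists>E. \<forall>\<phi> t. primed c \<phi> n t \<longrightarrow> settles \<phi> n t E"
proof (induction n arbitrary: c rule: less_induct)
  case (less n)
  show ?case
  proof (cases "n = 0")
    case True
    have "settles \<phi> n t 0" if "primed c \<phi> n t" for \<phi> t
      using that True by (auto simp: settles_def primed_def wall_def le_Suc_eq)
    then show ?thesis by blast
  next
    case False
    then have "1 \<le> n" by simp
    \<comment> \<open>The cells \<open>a\<close> and \<open>b\<close> are the middles, equal for odd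
      \<open>n\<close>; on either side of them \<open>m\<close> cells remain.\<close>
    define a b where "a = (n + 1) div 2" and "b = n div 2 + 1"
    define m where "m = n - b"
    have ab: "a = Suc m" "b + m = n" "a \<le> b" "b \<le> Suc a" "m < n" "a \<le> n"
      using False by (simp_all add: a_def b_def m_def)
    obtain d where d: "sreach n d (outw c n 1 n 1) (halved c n a b)"
      using outw_halve[of 1 n n c] \<open>1 \<le> n\<close> by (auto simp: a_def b_def)
    obtain E where E: "\<And>\<phi> t. primed (\<not> c) \<phi> m t \<Longrightarrow> settles \<phi> m t E"
      using less \<open>m < n\<close> by blast
    have "settles \<phi> n t (Suc d + E)" if "primed c \<phi> n t" for \<phi> t
    proof -
      define t' where "t' = Suc t + d"
      have seg: "segment \<phi> n" using that by (simp add: primed_def)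
      note first = segment_reach[OF d seg \<open>1 \<le> n\<close> primed_step[OF \<open>primed c \<phi> n t\<close> \<open>1 \<le> n\<close>]]
      have early: "st (Suc t + u) (\<phi> i) \<noteq> Fire" if "u < d" "i \<le> Suc n" for u i
        using first that by blast
      have at: "displays \<phi> n t' (halved c n a b)"
        using first by (simp add: t'_def)
      have early0: "st t (\<phi> i) \<noteq> Fire" if "i \<le> Suc n" for i
      proof -
        have "i = 0 \<or> i = Suc n \<or> (\<exists>j<n. i = Suc j)" using that by (cases i) force+
        then show ?thesis using \<open>primed c \<phi> n t\<close> by (auto simp: primed_def)
      qed
      have N: "N (\<phi> (Suc i)) = {\<phi> i, \<phi> (Suc (Suc i))}" if "i < n" for i
        using seg that by (simp add: segment_def)
      \<comment> \<open>A segment begins at its \<open>Gen\<close>, so the left half is read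
        backwards from \<open>a\<close> down to \<open>0 = a - Suc m\<close>.\<close>
      have "primed (\<not> c) (\<lambda>i. \<phi> (a - i)) m t'"
      proof -
        have "N (\<phi> (a - Suc i)) = {\<phi> (a - i), \<phi> (a - Suc (Suc i))}" if "i < m" for i
        proof -
          obtain k where "a = Suc (Suc (i + k))" using \<open>i < m\<close> ab
            by (metis add_Suc_right less_imp_Suc_add add_Suc)
          then show ?thesis using N[of k] ab by (auto simp: Suc_diff_le)
        qed
        moreover have "\<phi> (a - 1) \<in> N (\<phi> a)" using N[of m] ab by simp
        moreover have "\<phi> (a - m) \<in> N (\<phi> (a - Suc m))"
          using seg ab by (simp add: segment_def)
        ultimately show ?thesis
          using at ab by (auto simp: primed_def segment_def displays_def halved_def)
      qed
      then have L: "settles (\<lambda>i. \<phi> (a - i)) m t' E" by (rule E)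
      have "primed (\<not> c) (\<lambda>i. \<phi> (b + i)) m t'"
      proof -
        have "\<phi> (b + 1) \<in> N (\<phi> b)" using N[of "b - 1"] ab by auto
        moreover have "\<phi> (b + m) \<in> N (\<phi> (b + Suc m))"
          using seg ab by (simp add: segment_def)
        ultimately show ?thesis
          using at N ab by (auto simp: primed_def segment_def displays_def halved_def)
      qed
      then have R: "settles (\<lambda>i. \<phi> (b + i)) m t' E" by (rule E)
      have half: "(\<exists>j\<le>Suc m. i = a - j) \<or> (\<exists>j\<le>Suc m. i = b + j)" if "i \<le> Suc n" for i
      proof (cases "i \<le> a")
        case True
        then have "a - i \<le> Suc m" "i = a - (a - i)" using ab by simp_all
        then show ?thesis by blast
      next
        case False
        then have "i - b \<le> Suc m" "i = b + (i - b)" using ab that by simp_all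
        then show ?thesis by blast
      qed
      have late: "st (t' + u) (\<phi> i) \<noteq> Fire" if "u \<le> E" "i \<le> Suc n" for u i
        using half[OF that(2)] L R that(1) unfolding settles_def by blast
      have fin: "wall (st (t' + E) (\<phi> i))" if "i \<le> Suc n" for i
        using half[OF that] L R unfolding settles_def by blast
      have "st (t + u) (\<phi> i) \<noteq> Fire" if u: "u \<le> Suc d + E" and i: "i \<le> Suc n" for u i
      proof -
        consider "u = 0" | v where "v < d" "t + u = Suc t + v" | v where "v \<le> E" "t + u = t' + v"
        proof (cases "u \<le> d")
          case True
          then show ?thesis using that(1) that(2)[of "u - 1"] by (cases u) auto
        next
          case False
          then show ?thesis using that(3)[of "u - Suc d"] u by (auto simp: t'_def)
        qed
        then show ?thesis
        proof cases
          case 1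
          then show ?thesis using early0 i by simp
        next
          case (2 v)
          then show ?thesis using early i by presburger
        next
          case (3 v)
          then show ?thesis using late i by presburger
        qed
      qed
      then show ?thesis using fin unfolding settles_def t'_def by (simp add: add.assoc)
    qed
    then show ?thesis by blast
  qed
qed

end

subsection \<open>A solution for all paths\<close>

text \<open>The rules in \<open>cstep\<close> do not distinguish directions. The one exception is the first step: the general
  in state \<open>Init d\<close> wakes only its neighbour in direction \<open>eps d\<close>.\<close>

definition pstep :: "cell \<Rightarrow> cell option \<Rightarrow> cell option \<Rightarrow> cell option \<Rightarrow> cell option \<Rightarrow> cell" where
  "pstep x a0 a1 a2 a3 =
     (if x = Blank False \<and> (a0 = Some (Init 2) \<or> a1 = Some (Init 3) \<or> a2 = Some (Init 0) \<or> a3 = Some (Init 1))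
      then Scout False else cstep x {y. Some y \<in> {a0, a1, a2, a3}})"

text \<open>The final \<open>Fire\<close> serves the configuration of a single node, which fires at
  time 0.\<close>

definition start :: "bcond \<Rightarrow> cell" where
  "start b = (case b of (b0, b1, b2, b3) \<Rightarrow>
     if b0 then Init 0 else if b1 then Init 1 else if b2 then Init 2 else if b3 then Init 3 else Fire)"

text \<open>\<open>Init\<close> carries a natural number; the bound on it makes the state set
  finite.\<close>

definition cells :: "cell set" where
  "cells = {x. \<forall>d. x = Init d \<longrightarrow> d < 4}"

lemma finite_cells: "finite cells"
proof (rule finite_subset)
  show "cells \<subseteq> range Blank \<union> range (case_prod Head) \<union> range Tail \<union> range (case_prod Kick) \<union>
      range Far \<union> range Gen \<union> range Scout \<union> {Wall, Fire, Trail, Bounce} \<union> Init ` {..<4}"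
  proof
    fix x assume "x \<in> cells"
    then show "x \<in> range Blank \<union> range (case_prod Head) \<union> range Tail \<union> range (case_prod Kick) \<union>
      range Far \<union> range Gen \<union> range Scout \<union> {Wall, Fire, Trail, Bounce} \<union> Init ` {..<4}"
      by (cases x) (auto simp: cells_def intro: range_eqI[of _ _ "(a, b)" for a b])
  qed
qed simp

lemma cstep_not_Init: "cstep x N \<noteq> Init d"
  by (cases x) auto

lemma cstep_wall: "wall x \<Longrightarrow> \<forall>y\<in>N. wall y \<Longrightarrow> cstep x N = Fire"
  by (auto simp: wall_def)

lemma cstep_quiet: "N \<subseteq> {Blank False} \<Longrightarrow> cstep (Blank False) N = Blank False"
  by auto

interpretation A0: automaton "Blank False" start pstep cells "{Fire}"
proof
  show "finite cells" by (rule finite_cells)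
  show "start b \<in> cells" for b by (auto simp: start_def cells_def split: prod.splits)
  show "pstep x a b c d \<in> cells" for x a b c d by (auto simp: pstep_def cells_def cstep_not_Init)
  show "pstep (Blank False) a b c d = Blank False" if "{a, b, c, d} \<subseteq> {Some (Blank False), None}" for a b c d
  proof -
    have "{y. Some y \<in> {a, b, c, d}} \<subseteq> {Blank False}" using that by blast
    then have "cstep (Blank False) {y. Some y \<in> {a, b, c, d}} = Blank False" by (rule cstep_quiet)
    moreover have "\<not> (a = Some (Init 2) \<or> b = Some (Init 3) \<or> c = Some (Init 0) \<or> d = Some (Init 1))"
      using that by blast
    ultimately show ?thesis unfolding pstep_def by (simp only: simp_thms if_False)
  qed
qed (auto simp: cells_def)

lemma nbrs_dirs: "v \<in> nbrs S q \<longleftrightarrow>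
    v \<in> S \<and> v \<in> {padd q (eps 0), padd q (eps 1), padd q (eps 2), padd q (eps 3)}"
  unfolding nbrs_def adjacent_def ex_less_4 by blast

lemma seen_nbrs:
  "{y. Some y \<in> {sees S st q 0, sees S st q 1, sees S st q 2, sees S st q 3}} = st ` nbrs S q"
proof (rule set_eqI)
  fix y
  have seen: "Some y = sees S st q d \<longleftrightarrow> padd q (eps d) \<in> S \<and> y = st (padd q (eps d))" for d
    by (simp add: sees_def)
  have nbrs: "nbrs S q = S \<inter> {padd q (eps 0), padd q (eps 1), padd q (eps 2), padd q (eps 3)}"
    using nbrs_dirs by blast
  show "y \<in> {y. Some y \<in> {sees S st q 0, sees S st q 1, sees S st q 2, sees S st q 3}} \<longleftrightarrow>
      y \<in> st ` nbrs S q"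
    unfolding nbrs mem_Collect_eq insert_iff empty_iff seen by blast
qed

lemma pstep_sees:
  "pstep x (sees S st q 0) (sees S st q 1) (sees S st q 2) (sees S st q 3) =
     (if x = Blank False \<and> (sees S st q 0 = Some (Init 2) \<or> sees S st q 1 = Some (Init 3) \<or>
        sees S st q 2 = Some (Init 0) \<or> sees S st q 3 = Some (Init 1))
      then Scout False else cstep x (st ` nbrs S q))"
  unfolding pstep_def seen_nbrs by simp

lemma arun_no_Init: "A0.arun S (Suc t) q \<noteq> Init d"
  by (simp add: pstep_def cstep_not_Init)

text \<open>Time is shifted by one: the first step tells directions apart, and afterwards no
  \<open>Init\<close> is left, so that \<open>pstep\<close> reduces to \<open>cstep\<close>.\<close>

lemma cell_run_A0: "cell_run (nbrs S) (\<lambda>t. A0.arun S (Suc t))"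
proof
  fix t q
  have "sees S (A0.arun S (Suc t)) q d \<noteq> Some (Init e)" for d e
    using arun_no_Init by (auto simp: sees_def)
  then show "A0.arun S (Suc (Suc t)) q =
      cstep (A0.arun S (Suc t) q) (A0.arun S (Suc t) ` nbrs S q)"
    unfolding A0.arun.simps(2)[of S "Suc t"] pstep_sees by simp
qed

lemma arun_first:
  assumes "(0, 0) \<in> S" "start (bc S (0, 0)) = Init d" "d < 4"
  shows "A0.arun S 1 q = (if q = (0, 0) then Trail else if q = eps d then Scout False else Blank False)"
proof -
  let ?f = "A0.arun S 0"
  have seen: "sees S ?f q e = Some (Init d') \<longleftrightarrow> padd q (eps e) = (0, 0) \<and> d' = d" for e d'
    using assms by (auto simp: sees_def)
  have A: "A0.arun S 1 q =
      (if ?f q = Blank False \<and> (sees S ?f q 0 = Some (Init 2) \<or> sees S ?f q 1 = Some (Init 3) \<or>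
         sees S ?f q 2 = Some (Init 0) \<or> sees S ?f q 3 = Some (Init 1))
       then Scout False else cstep (?f q) (?f ` nbrs S q))"
    using pstep_sees by (simp only: One_nat_def A0.arun.simps(2))
  show ?thesis
  proof (cases "q = (0, 0)")
    case True
    then have "?f q = Init d" using assms by simp
    then show ?thesis unfolding A using True by simp
  next
    case False
    then have "?f q = Blank False" by simp
    moreover have "cstep (Blank False) (?f ` nbrs S q) = Blank False"
    proof -
      have "?f ` nbrs S q \<subseteq> {Init d, Blank False}" using assms by auto
      then show ?thesis by auto
    qed
    moreover have "(sees S ?f q 0 = Some (Init 2) \<or> sees S ?f q 1 = Some (Init 3) \<or>
        sees S ?f q 2 = Some (Init 0) \<or> sees S ?f q 3 = Some (Init 1)) \<longleftrightarrow> q = eps d"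
    proof -
      have "d = 0 \<or> d = 1 \<or> d = 2 \<or> d = 3" using assms(3) by linarith
      then show ?thesis unfolding seen by (elim disjE; cases q) (auto simp: padd_def eps_def)
    qed
    ultimately show ?thesis unfolding A using False by (simp only: if_True if_False simp_thms)
  qed
qed

section \<open>The journey of the scout and the firing of a whole path\<close>

context cell_run
begin

definition on_path :: "int \<Rightarrow> int \<Rightarrow> (int \<Rightarrow> 'v) \<Rightarrow> nat \<Rightarrow> (int \<Rightarrow> cell) \<Rightarrow> bool" where
  "on_path r s p t f \<longleftrightarrow> (\<forall>i\<in>{r..s}. st t (p i) = f i)"

lemma on_path_step:
  assumes "\<And>i. i \<in> {r..s} \<Longrightarrow> N (p i) = p ` ({i - 1, i + 1} \<inter> {r..s})"
    and "on_path r s p t f"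
    and "\<And>i. i \<in> {r..s} \<Longrightarrow>
      cstep (f i) {x. r < i \<and> x = f (i - 1) \<or> i < s \<and> x = f (i + 1)} = g i"
  shows "on_path r s p (Suc t) g"
  unfolding on_path_def
proof
  fix i assume i: "i \<in> {r..s}"
  have "st t ` p ` ({i - 1, i + 1} \<inter> {r..s}) = f ` ({i - 1, i + 1} \<inter> {r..s})"
    using assms(2) unfolding on_path_def image_image by (intro image_cong) auto
  also have "\<dots> = {x. r < i \<and> x = f (i - 1) \<or> i < s \<and> x = f (i + 1)}"
    using i by auto
  finally have "st t ` N (p i) = {x. r < i \<and> x = f (i - 1) \<or> i < s \<and> x = f (i + 1)}"
    using assms(1)[OF i] by simp
  then show "st (Suc t) (p i) = g i"
    using assms(2,3) i by (simp add: st_Suc on_path_def)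
qed

definition scouting :: "int \<Rightarrow> int \<Rightarrow> cell" where
  "scouting h i = (if i = h then Scout False else if i = h - 1 then Trail else Blank False)"

definition returning :: "int \<Rightarrow> int \<Rightarrow> int \<Rightarrow> cell" where
  "returning s h i = (if i = s then Wall else if i = h then Scout True
     else if i = h + 1 then Trail else Blank False)"

text \<open>The scout runs right to \<open>s\<close>, leaves a wall there, runs back past the
  general to \<open>r\<close> and becomes \<open>Gen False\<close>. Blank cells and
  \<open>Gen\<close> then have the same colour, as a primed segment demands.\<close>

lemma path_primes:
  assumes N: "\<And>i. i \<in> {r..s} \<Longrightarrow> N (p i) = p ` ({i - 1, i + 1} \<inter> {r..s})"
    and "r \<le> 0" "1 \<le> s" and "on_path r s p 0 (scouting 1)"
  shows "\<exists>T. (\<forall>t<T. \<forall>i\<in>{r..s}. st t (p i) \<noteq> Fire) \<and>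
    on_path r s p T (\<lambda>i. if i = s then Wall else if i = r then Gen False else Blank False)"
proof -
  have out: "on_path r s p u (scouting (int u + 1))" if "int u < s" for u
    using that
  proof (induction u)
    case 0
    then show ?case using assms by simp
  next
    case (Suc u)
    show ?case
    proof (rule on_path_step[OF N])
      show "on_path r s p u (scouting (int u + 1))" using Suc by simp
      fix i assume i: "i \<in> {r..s}"
      consider "i = int u + 1" | "i = int u + 2" | "i = int u" | "i < int u" | "i > int u + 2" by linarith
      then show "cstep (scouting (int u + 1) i) {x. r < i \<and> x = scouting (int u + 1) (i - 1) \<or> i < s \<and> x = scouting (int u + 1) (i + 1)}
          = scouting (int (Suc u) + 1) i"
        using i Suc.prems assms(2) by cases (auto simp: scouting_def)
    qed simp
  qed
  \<comment> \<open>At time \<open>u\<close> the scout stands at \<open>int u + 1\<close>, hence at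
    the end \<open>s\<close> at time \<open>k\<close>.\<close>
  obtain k where k: "s = int k + 1" using \<open>1 \<le> s\<close> by (metis add.commute zle_iff_zadd)
  let ?f = "\<lambda>i. if i = s then Bounce else Blank False"
  have bounce: "on_path r s p (Suc k) ?f"
  proof (rule on_path_step[OF N])
    show "on_path r s p k (scouting s)" using out[of k] k by simp
    fix i assume i: "i \<in> {r..s}"
    consider "i = s" | "i = s - 1" | "i < s - 1" using i by fastforce
    then show "cstep (scouting s i) {x. r < i \<and> x = scouting s (i - 1) \<or> i < s \<and> x = scouting s (i + 1)} = ?f i"
      using i assms by cases (auto simp: scouting_def)
  qed simp
  have ret0: "on_path r s p (Suc (Suc k)) (returning s (s - 1))"
  proof (rule on_path_step[OF N bounce])
    fix i assume i: "i \<in> {r..s}"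
    consider "i = s" | "i = s - 1" | "i < s - 1" using i by fastforce
    then show "cstep (?f i) {x. r < i \<and> x = ?f (i - 1) \<or> i < s \<and> x = ?f (i + 1)} = returning s (s - 1) i"
      using i assms by cases (auto simp: returning_def)
  qed simp
  have ret: "on_path r s p (Suc (Suc k) + u) (returning s (s - 1 - int u))" if "int u \<le> s - 1 - r" for u
    using that
  proof (induction u)
    case 0
    then show ?case using ret0 by simp
  next
    case (Suc u)
    define h where "h = s - 1 - int u"
    have h: "r < h" "h < s" using Suc.prems by (auto simp: h_def)
    have "on_path r s p (Suc (Suc (Suc k) + u)) (returning s (h - 1))"
    proof (rule on_path_step[OF N])
      show "on_path r s p (Suc (Suc k) + u) (returning s h)" using Suc by (simp add: h_def)
      fix i assume i: "i \<in> {r..s}"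
      consider "i = s" | "i = h" | "i = h - 1" | "i = h + 1" "i < s" | "i < h - 1" | "h + 1 < i" "i < s"
        using i by fastforce
      then show "cstep (returning s h i) {x. r < i \<and> x = returning s h (i - 1) \<or> i < s \<and> x = returning s h (i + 1)} = returning s (h - 1) i"
        using i h by cases (auto simp: returning_def wall_def)
    qed simp
    then show ?case by (simp add: h_def algebra_simps)
  qed
  define u where "u = nat (s - 1 - r)"
  define T where "T = Suc (Suc (Suc k) + u)"
  have last: "on_path r s p (Suc (Suc k) + u) (returning s r)"
    using ret[of u] assms by (simp add: u_def)
  let ?g = "\<lambda>i. if i = s then Wall else if i = r then Gen False else Blank False"
  have "on_path r s p T ?g"
    unfolding T_def
  proof (rule on_path_step[OF N last])
    fix i assume i: "i \<in> {r..s}"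
    consider "i = s" | "i = r" "r < s" | "i = r + 1" "i < s" | "r + 1 < i" "i < s" using i by fastforce
    then show "cstep (returning s r i) {x. r < i \<and> x = returning s r (i - 1) \<or> i < s \<and> x = returning s r (i + 1)} = ?g i"
      using i assms by cases (auto simp: returning_def wall_def)
  qed simp
  moreover have "st t (p i) \<noteq> Fire" if "t < T" "i \<in> {r..s}" for t i
  proof -
    have "int t < s \<or> t = Suc k \<or> (\<exists>v\<le>u. t = Suc (Suc k) + v)"
      using that(1) k unfolding T_def by presburger
    then consider "int t < s" | "t = Suc k" | v where "t = Suc (Suc k) + v" "v \<le> u" by blast
    then show ?thesis
    proof cases
      case 1
      then show ?thesis using out[of t] that by (auto simp: on_path_def scouting_def)
    next
      case 2
      then show ?thesis using bounce that by (auto simp: on_path_def)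
    next
      case (3 v)
      moreover have "int v \<le> s - 1 - r" using 3 assms by (simp add: u_def)
      ultimately show ?thesis using ret[of v] that
        by (auto simp: on_path_def returning_def)
    qed
  qed
  ultimately show ?thesis by blast
qed

text \<open>Once the segment between the two ends has settled, every node is a wall with wall
  neighbours only, and all fire in the next step.\<close>

lemma path_fires:
  assumes N: "\<And>i. i \<in> {r..s} \<Longrightarrow> N (p i) = p ` ({i - 1, i + 1} \<inter> {r..s})"
    and "r \<le> 0" "1 \<le> s" and "on_path r s p 0 (scouting 1)"
  shows "\<exists>T. (\<forall>t<T. \<forall>i\<in>{r..s}. st t (p i) \<noteq> Fire) \<and> (\<forall>i\<in>{r..s}. st T (p i) = Fire)"
proof -
  obtain T where T: "\<And>t i. t < T \<Longrightarrow> i \<in> {r..s} \<Longrightarrow> st t (p i) \<noteq> Fire"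
    and at: "on_path r s p T (\<lambda>i. if i = s then Wall else if i = r then Gen False else Blank False)"
    using path_primes[OF assms] by blast
  \<comment> \<open>The two end nodes serve as walls, so \<open>s - r - 1\<close> nodes lie
    inside.\<close>
  define n where "n = nat (s - r - 1)"
  define \<phi> where "\<phi> = (\<lambda>i. p (r + int i))"
  have n: "int n = s - r - 1" using assms by (simp add: n_def)
  have "primed False \<phi> n T"
  proof -
    have "N (\<phi> (Suc i)) = {\<phi> i, \<phi> (Suc (Suc i))}" if "i < n" for i
    proof -
      have "{r + int (Suc i) - 1, r + int (Suc i) + 1} \<inter> {r..s} = {r + int i, r + int (Suc (Suc i))}"
        using n that by auto
      then show ?thesis using N[of "r + int (Suc i)"] n that by (simp add: \<phi>_def)
    qed
    moreover have "\<phi> 1 \<in> N (\<phi> 0)" using N[of r] n by (auto simp: \<phi>_def)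
    moreover have "\<phi> n \<in> N (\<phi> (Suc n))"
    proof -
      have "r + int (Suc n) = s" "r + int n = s - 1" using n by simp_all
      then have "\<phi> (Suc n) = p s" "\<phi> n = p (s - 1)" by (simp_all only: \<phi>_def)
      moreover have "s - 1 \<in> {s - 1, s + 1} \<inter> {r..s}" using assms by simp
      ultimately show ?thesis using N[of s] assms by simp
    qed
    ultimately show ?thesis
      using at n by (auto simp: primed_def segment_def on_path_def \<phi>_def)
  qed
  then obtain E where E: "settles \<phi> n T E" using segment_settles by blast
  have \<phi>: "\<exists>j\<le>Suc n. p i = \<phi> j" if "i \<in> {r..s}" for i
    using that n by (intro exI[of _ "nat (i - r)"]) (auto simp: \<phi>_def)
  have walls: "wall (st (T + E) (p i))" if "i \<in> {r..s}" for i
    using \<phi>[OF that] E by (auto simp: settles_def)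
  have "st (Suc (T + E)) (p i) = Fire" if "i \<in> {r..s}" for i
  proof -
    have "\<forall>x \<in> st (T + E) ` N (p i). wall x" unfolding N[OF that] using walls by blast
    then show ?thesis using cstep_wall walls[OF that] by (simp add: st_Suc)
  qed
  moreover have "st t (p i) \<noteq> Fire" if "t < Suc (T + E)" "i \<in> {r..s}" for t i
  proof (cases "t < T")
    case True
    then show ?thesis using T that by blast
  next
    case False
    then have "t = T + (t - T)" "t - T \<le> E" using that by simp_all
    then obtain u where "t = T + u" "u \<le> E" by blast
    then show ?thesis using \<phi>[OF that(2)] E by (auto simp: settles_def)
  qed
  ultimately show ?thesis by blast
qed

end

lemma arun_fires_right:
  assumes path: "path r s p" and "start (bc (nodes r s p) (0, 0)) = Init d" "d < 4"
    and "1 \<le> s" "p 1 = eps d"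
  shows "\<exists>t. A0.afires (nodes r s p) t"
proof -
  let ?S = "nodes r s p"
  interpret cell_run "nbrs ?S" "\<lambda>t. A0.arun ?S (Suc t)" by (rule cell_run_A0)
  have r: "r \<le> 0" "p 0 = (0, 0)" "inj_on p {r..s}" using path by (auto simp: path_def)
  have S: "(0, 0) \<in> ?S" using r \<open>1 \<le> s\<close> by (auto simp: nodes_def intro: image_eqI[of _ _ 0])
  have inj: "p i = (0, 0) \<longleftrightarrow> i = 0" "p i = eps d \<longleftrightarrow> i = 1" if "i \<in> {r..s}" for i
    using inj_on_eq_iff[OF r(3) that, of 0] inj_on_eq_iff[OF r(3) that, of 1] r \<open>1 \<le> s\<close> \<open>p 1 = eps d\<close>
    by auto
  have "on_path r s p 0 (scouting 1)"
    unfolding on_path_def scouting_def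
    using arun_first[OF S assms(2,3)] inj by (auto simp del: A0.arun.simps)
  then obtain T where T: "\<And>t i. t < T \<Longrightarrow> i \<in> {r..s} \<Longrightarrow> A0.arun ?S (Suc t) (p i) \<noteq> Fire"
      "\<And>i. i \<in> {r..s} \<Longrightarrow> A0.arun ?S (Suc T) (p i) = Fire"
    using path_fires[of r s p] path_nbrs[OF path] r(1) \<open>1 \<le> s\<close> by meson
  have "A0.arun ?S t q \<noteq> Fire" if "t < Suc T" "q \<in> ?S" for t q
  proof (cases t)
    case 0
    then show ?thesis using assms(2) by simp
  next
    case (Suc u)
    then show ?thesis using T(1)[of u] that by (auto simp: nodes_def)
  qed
  then have "A0.afires ?S (Suc T)"
    using T(2) unfolding A0.afires_def nodes_def by blast
  then show ?thesis by blast
qed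

lemma arun_fires:
  assumes "path r s p"
  shows "\<exists>t. A0.afires (nodes r s p) t"
proof -
  let ?S = "nodes r s p"
  have p0: "p 0 = (0, 0)" "0 \<in> {r..s}" using assms by (auto simp: path_def)
  have "start (bc ?S (0, 0)) = Fire \<and> (\<forall>d\<in>{0,1,2,3}. padd (0, 0) (eps d) \<notin> ?S) \<or>
      (\<exists>d<4. start (bc ?S (0, 0)) = Init d \<and> padd (0, 0) (eps d) \<in> ?S)"
    unfolding ex_less_4 by (simp add: start_def bc_def)
  then consider "start (bc ?S (0, 0)) = Fire" "\<forall>d\<in>{0,1,2,3}. padd (0, 0) (eps d) \<notin> ?S"
    | d where "start (bc ?S (0, 0)) = Init d" "d < 4" "padd (0, 0) (eps d) \<in> ?S"
    by blast
  then show ?thesis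
  proof cases
    case 1
    have "nbrs ?S (p 0) = {}" using 1 unfolding p0 by (auto simp: nbrs_dirs)
    then have "{- 1, 1} \<inter> {r..s} = {}" using path_nbrs[OF assms p0(2)] by simp
    then have "r = 0" "s = 0" using p0(2) by auto
    then have "A0.afires ?S 0" using 1 p0 by (simp add: A0.afires_def nodes_def)
    then show ?thesis by blast
  next
    case init: (2 d)
    then have "eps d \<in> nbrs ?S (p 0)"
      using p0 by (auto simp: nbrs_def adjacent_def padd_def)
    then consider "p 1 = eps d" "1 \<le> s" | "p (- 1) = eps d" "r \<le> - 1"
      using path_nbrs[OF assms p0(2)] by auto
    then show ?thesis
    proof cases
      case 1
      then show ?thesis using arun_fires_right[OF assms] init by blast
    next
      case left: 2
      \<comment> \<open>In the reversed path the awakened neighbour has index 1.\<close>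
      show ?thesis
        using left arun_fires_right[OF path_reverse(1)[OF assms], of d] init path_reverse(2)[OF assms] by simp
    qed
  qed
qed

lemma solution_exists: "\<exists>A. is_solution A"
proof -
  obtain A where "wf_fsa A" "\<And>S t. fires_at A S t \<longleftrightarrow> A0.afires S t" using A0.realise by blast
  then have "is_solution A"
    using arun_fires by (auto simp: is_solution_def is_config_iff_path)
  then show ?thesis by blast
qed

subsection \<open>The lower bound\<close>

lemma padd_cancel: "padd a e = padd b e \<longleftrightarrow> a = b"
  by (cases a; cases b) (auto simp: padd_def)

lemma bc_mem:
  assumes "bc S q = bc S' q"
  shows "padd q (eps d) \<in> S \<longleftrightarrow> padd q (eps d) \<in> S'"
proof -
  have "eps d \<in> {eps 0, eps 1, eps 2, eps 3}" by (simp add: eps_def)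
  then show ?thesis using assms by (auto simp: bc_def)
qed

lemma wf_fsa_gen:
  assumes "wf_fsa A"
  shows "gen A (tau A b) \<in> states A"
proof -
  have "\<forall>i < ngen A. gen A i \<in> states A"
    using assms unfolding wf_fsa_def by (elim conjE)
  moreover have "\<forall>b. tau A b < ngen A"
    using assms unfolding wf_fsa_def by (elim conjE)
  ultimately show ?thesis by blast
qed

lemma wf_fsa_closed:
  assumes "wf_fsa A" "x \<in> states A"
    and "set_option a \<union> set_option b \<union> set_option c \<union> set_option d \<subseteq> states A"
  shows "delta A x a b c d \<in> states A"
proof -
  have closed: "\<forall>x a b c d. x \<in> states A \<and>
        (\<forall>y. a = Some y \<longrightarrow> y \<in> states A) \<and> (\<forall>y. b = Some y \<longrightarrow> y \<in> states A) \<and>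
        (\<forall>y. c = Some y \<longrightarrow> y \<in> states A) \<and> (\<forall>y. d = Some y \<longrightarrow> y \<in> states A)
        \<longrightarrow> delta A x a b c d \<in> states A"
    using assms(1) unfolding wf_fsa_def by (elim conjE)
  show ?thesis by (rule closed[rule_format]) (use assms(2,3) in auto)
qed

lemma wf_fsa_quiet:
  assumes "wf_fsa A" "{a, b, c, d} \<subseteq> {Some (quiescent A), None}"
  shows "delta A (quiescent A) a b c d = quiescent A"
proof -
  have "\<forall>a b c d. a \<in> {Some (quiescent A), None} \<and> b \<in> {Some (quiescent A), None} \<and>
      c \<in> {Some (quiescent A), None} \<and> d \<in> {Some (quiescent A), None}
      \<longrightarrow> delta A (quiescent A) a b c d = quiescent A"
    using assms(1) unfolding wf_fsa_def by (elim conjE)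
  then show ?thesis using assms(2) by (simp only: insert_subset simp_thms)
qed

lemma path_origin:
  assumes "path r s p" "i \<in> {r..s}"
  shows "p i = (0, 0) \<longleftrightarrow> i = 0"
proof -
  have "p 0 = (0, 0)" "0 \<in> {r..s}" "inj_on p {r..s}" using assms by (auto simp: path_def)
  then show ?thesis using inj_on_eq_iff[of p "{r..s}" i 0] assms by simp
qed

lemma path_next:
  assumes "path r s p" "i \<in> {r..s}" "padd (p i) (eps d) \<in> nodes r s p"
  obtains j where "j \<in> {r..s}" "\<bar>i - j\<bar> = 1" "padd (p i) (eps d) = p j"
  using assms adjacent_eps[of "p i" d] by (fastforce simp: nodes_def path_def)

lemma path_dir:
  assumes "path r s p" "i \<in> {r..s}" "j \<in> {r..s}" "\<bar>i - j\<bar> = 1"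
  obtains d where "d < 4" "p j = padd (p i) (eps d)"
proof -
  have "adjacent (p i) (p j)" using assms by (simp add: path_def)
  then show ?thesis using that by (auto simp: adjacent_def)
qed

text \<open>The signal of the general advances by at most one node per step.\<close>

lemma run_quiescent:
  assumes "wf_fsa A" "path r s p" "i \<in> {r..s}" "int t < \<bar>i\<bar>"
  shows "run A (nodes r s p) t (p i) = quiescent A"
  using assms(3,4)
proof (induction t arbitrary: i)
  case 0
  then show ?case using path_origin[OF assms(2)] by simp
next
  case (Suc t)
  let ?S = "nodes r s p"
  have "nbr ?S (run A ?S t) (p i) d \<in> {Some (quiescent A), None}" for d
  proof (cases "padd (p i) (eps d) \<in> ?S")
    case True
    then obtain j where "j \<in> {r..s}" "\<bar>i - j\<bar> = 1" "padd (p i) (eps d) = p j"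
      using path_next[OF assms(2) Suc.prems(1)] by blast
    then show ?thesis using Suc by (simp add: nbr_def)
  qed (simp add: nbr_def)
  moreover have "run A ?S t (p i) = quiescent A" using Suc by simp
  ultimately show ?case using assms(1) by (simp add: wf_fsa_def)
qed

text \<open>The two configurations differ only beyond \<open>p r\<close>; that difference is first visible at
  \<open>p r\<close> at time \<open>-r\<close> and reaches \<open>p i\<close> at time \<open>-r + (i - r)\<close>.\<close>

lemma run_agree:
  assumes "wf_fsa A" "path r s p" "path r' s' p'" "r < 0"
    and "r \<in> {r'..s'}" "p' r = p r"
    and same: "\<And>i. i \<in> {r + 1..s} \<Longrightarrow> bc (nodes r' s' p') (p i) = bc (nodes r s p) (p i)"
    and "i \<in> {r..s}" "int t < i - 2 * r"
  shows "run A (nodes r' s' p') t (p i) = run A (nodes r s p) t (p i)"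
  using assms(8,9)
proof (induction t arbitrary: i)
  case 0
  have "p 0 = (0, 0)" "0 \<in> {r + 1..s}" using assms by (auto simp: path_def)
  then show ?case using same[of 0] by simp
next
  case (Suc t)
  let ?S = "nodes r s p" and ?S' = "nodes r' s' p'"
  show ?case
  proof (cases "i = r")
    case True
    \<comment> \<open>The boundary conditions at \<open>p r\<close> may differ, but up to this time
      \<open>p r\<close> is quiescent in both runs.\<close>
    then have "int (Suc t) < \<bar>r\<bar>" using Suc.prems assms(4) by simp
    then show ?thesis
      using run_quiescent[OF assms(1,2) Suc.prems(1)] run_quiescent[OF assms(1,3,5)] True assms(6)
      by (simp del: run.simps)
  next
    case False
    then have i: "i \<in> {r + 1..s}" using Suc.prems by simp
    have "nbr ?S' (run A ?S' t) (p i) d = nbr ?S (run A ?S t) (p i) d" for d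
    proof (cases "padd (p i) (eps d) \<in> ?S")
      case True
      then obtain j where "j \<in> {r..s}" "\<bar>i - j\<bar> = 1" "padd (p i) (eps d) = p j"
        using path_next[OF assms(2) Suc.prems(1)] by blast
      then show ?thesis using Suc bc_mem[OF same[OF i], of d] True by (simp add: nbr_def)
    next
      case False
      then show ?thesis using bc_mem[OF same[OF i], of d] by (simp add: nbr_def)
    qed
    moreover have "run A ?S' t (p i) = run A ?S t (p i)" using Suc by simp
    ultimately show ?thesis by simp
  qed
qed

lemma config_list_path:
  assumes "config_list cs k"
  defines "q \<equiv> \<lambda>i. cs ! nat (i + int k)"
  shows "path (- int k) (int (length cs) - 1 - int k) q"
    "nodes (- int k) (int (length cs) - 1 - int k) q = set cs"
proof -
  let ?s = "int (length cs) - 1 - int k"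
  have k: "k < length cs" using assms by (simp add: config_list_def)
  have map: "map q [- int k..?s] = cs"
    by (rule nth_equalityI) (simp_all add: q_def nth_upto)
  then have "is_config (- int k) ?s q"
    using assms k by (simp add: is_config_def)
  then show "path (- int k) ?s q" by (simp add: is_config_iff_path)
  have "nodes (- int k) ?s q = set (map q [- int k..?s])" by (simp add: nodes_def)
  then show "nodes (- int k) ?s q = set cs" by (simp only: map)
qed

lemma firing_time_lower_bound:
  assumes sol: "is_solution A" and path: "path r s p" and "r < 0" "0 < s"
    and free: "fW r s p (r + 1) s = \<infinity>" and fires: "fires_at A (nodes r s p) T"
  shows "- 2 * r + s \<le> int T"
proof (rule ccontr)
  assume "\<not> - 2 * r + s \<le> int T"
  then have T: "int T < s - 2 * r" by simp
  \<comment> \<open>An infinite supremum of lengths exceeds every bound, in particular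
    \<open>T\<close>.\<close>
  have "\<exists>(x0, x1) \<in> W r s p (r + 1) s. T < length x0"
  proof (rule ccontr)
    assume "\<not> (\<exists>(x0, x1) \<in> W r s p (r + 1) s. T < length x0)"
    then have "fW r s p (r + 1) s \<le> enat T" unfolding fW_def by (intro Sup_least) fastforce
    then show False using free by simp
  qed
  then obtain x0 x1 where W: "(x0, x1) \<in> W r s p (r + 1) s" and x0: "T < length x0" by blast
  define cs where "cs = x0 @ map p [r + 1..s] @ x1"
  define k where "k = length x0 + nat (- (r + 1))"
  define r' s' p' where "r' = - int k" and "s' = int (length cs) - 1 - int k"
    and "p' = (\<lambda>i. cs ! nat (i + int k))"
  let ?S = "nodes r s p" and ?S' = "nodes r' s' p'"
  have cfg: "config_list cs k" using W by (simp add: W_def cs_def k_def)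
  have path': "path r' s' p'" and set: "?S' = set cs"
    using config_list_path[OF cfg] by (simp_all add: r'_def s'_def p'_def)
  have k: "int k = int (length x0) - r - 1" using \<open>r < 0\<close> by (simp add: k_def)
  have len: "length cs = length x0 + nat (s - r) + length x1" by (simp add: cs_def)
  have same: "bc ?S' (p i) = bc ?S (p i)" if "i \<in> {r + 1..s}" for i
    using W that unfolding set by (simp add: W_def cs_def)
  have range: "i \<in> {r'..s'}" if "i \<in> {r..s}" for i
    using that x0 by (simp add: r'_def s'_def k len)
  have p': "p' i = p i" if "i \<in> {r + 1..s}" for i
  proof -
    have "nat (i + int k) = length x0 + nat (i - r - 1)" using that k by auto
    then show ?thesis using that by (simp add: p'_def cs_def nth_append nth_upto)
  qed
  have r1: "r \<in> {r..s}" "r + 1 \<in> {r..s}" "r + 2 \<in> {r + 1..s}" using \<open>r < 0\<close> \<open>0 < s\<close> by simp_all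
  \<comment> \<open>The common part starts only at \<open>r + 1\<close>. Equal boundary conditions
    at \<open>p (r + 1)\<close> put \<open>p r\<close> into the extension as a neighbour of that
    node; the neighbour on the other side is \<open>p (r + 2)\<close>, so \<open>p r\<close> has
    index \<open>r\<close> there too.\<close>
  have p'r: "p' r = p r"
  proof -
    obtain d where d: "p r = padd (p (r + 1)) (eps d)"
      using path_dir[OF path r1(2,1)] by auto
    moreover have "p r \<in> ?S" using r1 by (simp add: nodes_def)
    ultimately have "padd (p' (r + 1)) (eps d) \<in> ?S'"
      using bc_mem[OF same[of "r + 1"], of d] p'[of "r + 1"] r1 by simp
    then obtain j where j: "j \<in> {r'..s'}" "\<bar>r + 1 - j\<bar> = 1" "p r = p' j"
      using path_next[OF path' range[OF r1(2)]] d p'[of "r + 1"] r1 by (metis atLeastAtMost_iff order_refl)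
    have "j \<noteq> r + 2"
    proof
      assume "j = r + 2"
      then have "p r = p (r + 2)" using j p' r1 by simp
      then show False using path r1 inj_on_eq_iff[of p "{r..s}" r "r + 2"] by (simp add: path_def)
    qed
    then have "j = r" using j(2) by linarith
    then show ?thesis using j by simp
  qed
  have wf: "wf_fsa A" using sol by (simp add: is_solution_def)
  obtain t where t: "fires_at A ?S' t"
    using sol path' unfolding is_solution_def is_config_iff_path by blast
  have s: "s \<in> {r..s}" "s \<in> {r + 1..s}" using \<open>r < 0\<close> \<open>0 < s\<close> by simp_all
  have "run A ?S' T (p s) = run A ?S T (p s)"
    using run_agree[OF wf path path' \<open>r < 0\<close> range[OF r1(1)] p'r same s(1)] T by simp
  moreover have "run A ?S T (p s) \<in> firing A" using fires s by (simp add: fires_at_def nodes_def)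
  moreover have "p s \<in> ?S'" using p'[OF s(2)] range[OF s(1)] by (force simp: nodes_def)
  ultimately have "t \<le> T" using t by (metis fires_at_def not_le)
  \<comment> \<open>The left end of the extension lies \<open>length x0 - r - 1\<close> steps from
    the general, which exceeds \<open>T\<close>, so it is still quiescent at the firing time
    \<open>t\<close>.\<close>
  have r': "r' \<in> {r'..s'}" using path' by (simp add: path_def)
  have "int t < \<bar>r'\<bar>" using \<open>t \<le> T\<close> x0 \<open>r < 0\<close> by (simp add: r'_def k)
  then have "run A ?S' t (p' r') = quiescent A" by (rule run_quiescent[OF wf path' r'])
  moreover have "run A ?S' t (p' r') \<in> firing A" using t r' by (simp add: fires_at_def nodes_def)
  ultimately show False using wf by (simp add: wf_fsa_def)
qed

subsection \<open>Recognising one configuration in time\<close>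

text \<open>Own position, clock and the set of verified positions; \<open>None\<close> means that
  nothing is known. In the inputs a further \<open>option\<close> accounts for absent
  neighbours.\<close>

type_synonym know = "(pos \<times> nat \<times> pos set) option"

definition heard :: "know option set \<Rightarrow> pos set" where
  "heard I = \<Union>{K. \<exists>q t. Some (Some (q, t, K)) \<in> I}"

text \<open>The possible pairs of own position and time for a node that has just been reached: a neighbour
  in direction \<open>eps d\<close> that knows itself to be at \<open>padd q (eps d)\<close> reveals the position \<open>q\<close>.\<close>

definition wake :: "pos set \<Rightarrow> nat \<Rightarrow> know option \<Rightarrow> know option \<Rightarrow> know option \<Rightarrow> know option \<Rightarrow>
    (pos \<times> nat) set" where
  "wake S0 T a0 a1 a2 a3 = {(q, t). t < T \<and> q \<in> S0 \<and>
     bc S0 q = (a0 \<noteq> None, a1 \<noteq> None, a2 \<noteq> None, a3 \<noteq> None) \<and>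
     (\<exists>K. a0 = Some (Some (padd q (eps 0), t, K)) \<or> a1 = Some (Some (padd q (eps 1), t, K)) \<or>
       a2 = Some (Some (padd q (eps 2), t, K)) \<or> a3 = Some (Some (padd q (eps 3), t, K)))}"

text \<open>Knowledge is dropped after time \<open>T\<close>, which bounds the clock and keeps the
  states finite. On arbitrary inputs \<open>wake\<close> may offer several pairs, hence the choice;
  in an actual run every pair offered is the true one.\<close>

definition kstep :: "pos set \<Rightarrow> nat \<Rightarrow> know \<Rightarrow> know option \<Rightarrow> know option \<Rightarrow> know option \<Rightarrow>
    know option \<Rightarrow> know" where
  "kstep S0 T x a0 a1 a2 a3 = (case x of
     Some (q, t, K) \<Rightarrow> if t < T then Some (q, Suc t, K \<union> heard {a0, a1, a2, a3}) else None
   | None \<Rightarrow> if wake S0 T a0 a1 a2 a3 = {} then None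
       else (case SOME z. z \<in> wake S0 T a0 a1 a2 a3 of
         (q, t) \<Rightarrow> Some (q, Suc t, insert q (heard {a0, a1, a2, a3}))))"

lemma kstep_None:
  "wake S0 T a0 a1 a2 a3 = {} \<Longrightarrow> kstep S0 T None a0 a1 a2 a3 = None"
  "wake S0 T a0 a1 a2 a3 \<noteq> {} \<Longrightarrow> \<exists>(q, t) \<in> wake S0 T a0 a1 a2 a3.
     kstep S0 T None a0 a1 a2 a3 = Some (q, Suc t, insert q (heard {a0, a1, a2, a3}))"
proof -
  assume ne: "wake S0 T a0 a1 a2 a3 \<noteq> {}"
  define z where "z = (SOME z. z \<in> wake S0 T a0 a1 a2 a3)"
  have "z \<in> wake S0 T a0 a1 a2 a3" using ne by (simp add: z_def some_in_eq)
  then show "\<exists>(q, t) \<in> wake S0 T a0 a1 a2 a3.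
     kstep S0 T None a0 a1 a2 a3 = Some (q, Suc t, insert q (heard {a0, a1, a2, a3}))"
    using ne unfolding kstep_def z_def[symmetric] by (intro bexI[of _ z]) (simp_all split: prod.splits)
qed (simp add: kstep_def)

text \<open>If the boundary condition of the general does not fit \<open>S0\<close>, it starts with
  \<open>None\<close> and no node ever wakes.\<close>

definition kstart :: "pos set \<Rightarrow> bcond \<Rightarrow> know" where
  "kstart S0 b = (if b = bc S0 (0, 0) then Some ((0, 0), 0, {(0, 0)}) else None)"

primrec krun :: "pos set \<Rightarrow> nat \<Rightarrow> pos set \<Rightarrow> nat \<Rightarrow> pos \<Rightarrow> know" where
  "krun S0 T S 0 q = (if q = (0, 0) then kstart S0 (bc S (0, 0)) else None)"
| "krun S0 T S (Suc t) q = kstep S0 T (krun S0 T S t q) (sees S (krun S0 T S t) q 0)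
     (sees S (krun S0 T S t) q 1) (sees S (krun S0 T S t) q 2) (sees S (krun S0 T S t) q 3)"

definition inputs :: "pos set \<Rightarrow> (pos \<Rightarrow> 'a) \<Rightarrow> pos \<Rightarrow> 'a option set" where
  "inputs S st q = {sees S st q 0, sees S st q 1, sees S st q 2, sees S st q 3}"

lemma sees_inputs: "d < 4 \<Longrightarrow> sees S st q d \<in> inputs S st q"
  unfolding inputs_def by (auto simp: numeral_eq_Suc less_Suc_eq)

lemma inputs_sees: "x \<in> inputs S st q \<Longrightarrow> \<exists>d. x = sees S st q d"
  by (auto simp: inputs_def)

lemma wake_sees:
  "wake S0 T (sees S st q 0) (sees S st q 1) (sees S st q 2) (sees S st q 3) =
     {(q', t). t < T \<and> q' \<in> S0 \<and> bc S0 q' = bc S q \<and>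
       (\<exists>d<4. \<exists>K. sees S st q d = Some (Some (padd q' (eps d), t, K)))}"
proof -
  have "sees S st q d \<noteq> None \<longleftrightarrow> padd q (eps d) \<in> S" for d by (simp add: sees_def)
  then have "(sees S st q 0 \<noteq> None, sees S st q 1 \<noteq> None, sees S st q 2 \<noteq> None, sees S st q 3 \<noteq> None)
      = bc S q"
    by (simp only: bc_def)
  then show ?thesis unfolding wake_def ex_less_4 by (simp only:) blast
qed

text \<open>Knowledge is truthful on every actual node set \<open>S\<close>: a waking node takes
  position and time from a neighbour for which they are already right, and every position enters
  \<open>K\<close> only after its boundary condition has been compared.\<close>

lemma krun_sound:
  assumes "(0, 0) \<in> S0" "q \<in> S" "krun S0 T S t q = Some (q', t', K)"
  shows "q' = q \<and> t' = t \<and> t \<le> T \<and> q \<in> K \<and> K \<subseteq> {v \<in> S \<inter> S0. bc S v = bc S0 v}"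
  using assms(2,3)
proof (induction t arbitrary: q q' t' K)
  case 0
  then show ?case using assms(1) by (auto simp: kstart_def split: if_splits)
next
  case (Suc t)
  let ?st = "krun S0 T S t"
  let ?I = "inputs S ?st q"
  let ?W = "wake S0 T (sees S ?st q 0) (sees S ?st q 1) (sees S ?st q 2) (sees S ?st q 3)"
  let ?G = "{v \<in> S \<inter> S0. bc S v = bc S0 v}"
  have seen: "padd q (eps d) \<in> S \<and> q2 = padd q (eps d) \<and> t2 = t \<and> K2 \<subseteq> ?G"
    if "sees S ?st q d = Some (Some (q2, t2, K2))" for d q2 t2 K2
  proof -
    have "padd q (eps d) \<in> S" "?st (padd q (eps d)) = Some (q2, t2, K2)"
      using that by (auto simp: sees_def split: if_splits)
    then show ?thesis using Suc.IH by blast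
  qed
  have heard: "heard ?I \<subseteq> ?G"
    unfolding heard_def
  proof (rule Union_least)
    fix L assume "L \<in> {K. \<exists>q t. Some (Some (q, t, K)) \<in> ?I}"
    then obtain q2 t2 where "Some (Some (q2, t2, L)) \<in> ?I" by blast
    then obtain d where "sees S ?st q d = Some (Some (q2, t2, L))" using inputs_sees by metis
    then show "L \<subseteq> ?G" using seen by blast
  qed
  have st: "kstep S0 T (?st q) (sees S ?st q 0) (sees S ?st q 1) (sees S ?st q 2) (sees S ?st q 3)
      = Some (q', t', K)"
    using Suc.prems(2) by simp
  show ?case
  proof (cases "?st q")
    case None
    then have ne: "?W \<noteq> {}" using st by (auto simp: kstep_def)
    obtain q1 t1 where W: "(q1, t1) \<in> ?W"
      and "Some (q', t', K) = Some (q1, Suc t1, insert q1 (heard ?I))"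
      using kstep_None(2)[OF ne] st unfolding None inputs_def by force
    then have res: "q' = q1" "t' = Suc t1" "K = insert q1 (heard ?I)" by simp_all
    obtain d K1 where *: "t1 < T" "q1 \<in> S0" "bc S0 q1 = bc S q"
        "sees S ?st q d = Some (Some (padd q1 (eps d), t1, K1))"
      using W unfolding wake_sees by blast
    then have "q1 = q" "t1 = t" using seen[OF *(4)] by (simp_all add: padd_cancel)
    then show ?thesis using * res heard Suc.prems(1) by auto
  next
    case (Some a)
    obtain q1 t1 K1 where a: "a = (q1, t1, K1)" by (cases a)
    then have "q1 = q \<and> t1 = t \<and> t \<le> T \<and> q \<in> K1 \<and> K1 \<subseteq> ?G" using Suc Some by blast
    moreover have "t1 < T" "q' = q1" "t' = Suc t1" "K = K1 \<union> heard ?I"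
      using st Some a by (auto simp: kstep_def inputs_def split: if_splits)
    ultimately show ?thesis using heard by auto
  qed
qed

text \<open>On \<open>S0\<close> itself news travels at full speed: \<open>p j\<close> wakes at time
  \<open>\<bar>j\<bar>\<close>, and its position needs \<open>\<bar>i - j\<bar>\<close> further
  steps to \<open>p i\<close>.\<close>

lemma krun_complete:
  assumes path: "path r s p" and S0: "S0 = nodes r s p"
    and "i \<in> {r..s}" "\<bar>i\<bar> \<le> int t" "t \<le> T"
  shows "\<exists>K. krun S0 T S0 t (p i) = Some (p i, t, K) \<and>
    (\<forall>j\<in>{r..s}. \<bar>j\<bar> + \<bar>i - j\<bar> \<le> int t \<longrightarrow> p j \<in> K)"
  using assms(3-5)
proof (induction t arbitrary: i)
  case 0
  then show ?case using path by (auto simp: path_def kstart_def)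
next
  case (Suc t)
  have p0: "p 0 = (0, 0)" "0 \<in> {r..s}" "(0, 0) \<in> S0"
    using path by (force simp: path_def S0 nodes_def)+
  let ?st = "krun S0 T S0 t"
  let ?q = "p i"
  let ?I = "inputs S0 ?st ?q"
  let ?W = "wake S0 T (sees S0 ?st ?q 0) (sees S0 ?st ?q 1) (sees S0 ?st ?q 2) (sees S0 ?st ?q 3)"
  have q: "?q \<in> S0" using Suc.prems by (simp add: S0 nodes_def)
  have sound: "q' = q \<and> t' = t \<and> q \<in> K" if "q \<in> S0" "?st q = Some (q', t', K)" for q q' t' K
    using krun_sound[OF p0(3)] that by blast
  have nb: "\<exists>d<4. \<exists>K. sees S0 ?st ?q d = Some (Some (padd ?q (eps d), t, K)) \<and>
      (\<forall>j\<in>{r..s}. \<bar>j\<bar> + \<bar>i' - j\<bar> \<le> int t \<longrightarrow> p j \<in> K)"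
    if i': "i' \<in> {r..s}" "\<bar>i - i'\<bar> = 1" "\<bar>i'\<bar> \<le> int t" for i'
  proof -
    obtain d where d: "d < 4" "p i' = padd ?q (eps d)"
      using path_dir[OF path Suc.prems(1) i'(1,2)] by blast
    obtain K where "?st (p i') = Some (p i', t, K)"
        "\<forall>j\<in>{r..s}. \<bar>j\<bar> + \<bar>i' - j\<bar> \<le> int t \<longrightarrow> p j \<in> K"
      using Suc.IH[OF i'(1,3)] Suc.prems by auto
    moreover have "p i' \<in> S0" using i' by (simp add: S0 nodes_def)
    ultimately show ?thesis using d by (auto simp: sees_def)
  qed
  have "\<exists>K. krun S0 T S0 (Suc t) ?q = Some (?q, Suc t, K) \<and> ?q \<in> K \<and> heard ?I \<subseteq> K"
  proof (cases "?st ?q")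
    case None
    have "i \<noteq> 0" using None Suc.IH[of 0] p0(2) Suc.prems by auto
    \<comment> \<open>This is the index of the neighbour on the side of the general, which is awake
      already.\<close>
    then have "i - sgn i \<in> {r..s}" "\<bar>i - (i - sgn i)\<bar> = 1" "\<bar>i - sgn i\<bar> \<le> int t"
      using Suc.prems p0(2) by (auto simp: sgn_if)
    then have "(?q, t) \<in> ?W"
      using nb Suc.prems q unfolding wake_sees by fastforce
    then have ne: "?W \<noteq> {}" by blast
    obtain q1 t1 where W: "(q1, t1) \<in> ?W"
      and res: "krun S0 T S0 (Suc t) ?q = Some (q1, Suc t1, insert q1 (heard ?I))"
      using kstep_None(2)[OF ne] None unfolding inputs_def krun.simps(2) by force
    then obtain d K1 where "sees S0 ?st ?q d = Some (Some (padd q1 (eps d), t1, K1))"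
      unfolding wake_sees by blast
    then have "q1 = ?q" "t1 = t"
      using sound[of "padd ?q (eps d)"] by (auto simp: sees_def padd_cancel split: if_splits)
    then show ?thesis using res by blast
  next
    case (Some a)
    obtain q1 t1 K1 where a: "a = (q1, t1, K1)" by (cases a)
    then have "q1 = ?q \<and> t1 = t \<and> ?q \<in> K1" using sound q Some by blast
    then show ?thesis using Some a Suc.prems by (auto simp: kstep_def inputs_def)
  qed
  then obtain K where K: "krun S0 T S0 (Suc t) ?q = Some (?q, Suc t, K)" "?q \<in> K" "heard ?I \<subseteq> K"
    by blast
  have "p j \<in> K" if j: "j \<in> {r..s}" "\<bar>j\<bar> + \<bar>i - j\<bar> \<le> int (Suc t)" for j
  proof (cases "j = i")
    case True
    then show ?thesis using K by simp
  next
    case False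
    \<comment> \<open>The neighbour one step closer to \<open>j\<close>, through which the news of
      \<open>p j\<close> arrives.\<close>
    define i' where "i' = i - sgn (i - j)"
    have "i' \<in> {r..s}" "\<bar>i - i'\<bar> = 1" "\<bar>j\<bar> + \<bar>i' - j\<bar> \<le> int t" "\<bar>i'\<bar> \<le> int t"
      using False j Suc.prems(1) by (auto simp: i'_def sgn_if)
    then obtain d K' where d: "d < 4" "sees S0 ?st ?q d = Some (Some (padd ?q (eps d), t, K'))" "p j \<in> K'"
      using nb j by blast
    then have "Some (Some (padd ?q (eps d), t, K')) \<in> ?I" using sees_inputs[OF d(1), of S0 ?st ?q] by simp
    then have "p j \<in> heard ?I" using d(3) unfolding heard_def by blast
    then show ?thesis using K by blast
  qed
  then show ?case using K by blast
qed

text \<open>Walking from the general in both directions, each node in \<open>S0\<close> has the same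
  neighbours in the path as in \<open>S0\<close>; so the path never leaves
  \<open>S0\<close>.\<close>

lemma path_rigid:
  assumes path: "path r s p" and "(0, 0) \<in> S0" "S0 \<subseteq> nodes r s p"
    and same: "\<And>v. v \<in> S0 \<Longrightarrow> bc (nodes r s p) v = bc S0 v"
  shows "nodes r s p = S0"
proof -
  have step: "p j \<in> S0" if near: "p i \<in> S0" "i \<in> {r..s}" "j \<in> {r..s}" "\<bar>i - j\<bar> = 1" for i j
  proof -
    obtain d where "p j = padd (p i) (eps d)" using path_dir[OF path near(2-4)] by blast
    moreover have "p j \<in> nodes r s p" using near by (simp add: nodes_def)
    ultimately show ?thesis using bc_mem[OF same[OF near(1)], of d] near(1) by simp
  qed
  have r: "r \<le> 0" "0 \<le> s" "p 0 = (0, 0)" using path by (auto simp: path_def)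
  have up: "int n \<le> s \<Longrightarrow> p (int n) \<in> S0" for n
  proof (induction n)
    case 0
    then show ?case using assms r by simp
  next
    case (Suc n)
    then show ?case using step[of "int n" "int (Suc n)"] r by simp
  qed
  have down: "r \<le> - int n \<Longrightarrow> p (- int n) \<in> S0" for n
  proof (induction n)
    case 0
    then show ?case using assms r by simp
  next
    case (Suc n)
    then show ?case using step[of "- int n" "- int (Suc n)"] r by simp
  qed
  have "p i \<in> S0" if "i \<in> {r..s}" for i
    using up[of "nat i"] down[of "nat (- i)"] that by (cases "0 \<le> i") auto
  then show ?thesis using assms(3) by (auto simp: nodes_def)
qed

text \<open>A product of a given solution with the knowledge automaton. On a configuration other
  than \<open>S0\<close> the second component never causes firing; on \<open>S0\<close> it does so
  at time \<open>T\<close>, unless the solution has fired before.\<close>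

lemma firing_time_upper_bound:
  assumes path: "path r s p"
    and T: "\<And>i j. i \<in> {r..s} \<Longrightarrow> j \<in> {r..s} \<Longrightarrow> \<bar>j\<bar> + \<bar>i - j\<bar> \<le> int T"
  shows "\<exists>A t. is_solution A \<and> fires_at A (nodes r s p) t \<and> t \<le> T"
proof -
  obtain A where A: "is_solution A" using solution_exists by blast
  then have wf: "wf_fsa A" by (simp add: is_solution_def)
  define S0 where "S0 = nodes r s p"
  have origin: "(0, 0) \<in> S0" using path by (force simp: path_def S0_def nodes_def)
  define \<Sigma>k :: "know set" where "\<Sigma>k = insert None (Some ` (S0 \<times> {..T} \<times> Pow S0))"
  define \<Sigma> where "\<Sigma> = states A \<times> \<Sigma>k"
  \<comment> \<open>Nodes may complete \<open>S0\<close> at different times; requiring the clock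
    value \<open>T\<close> makes them fire together.\<close>
  define Fs where "Fs = {(x, k) \<in> \<Sigma>. x \<in> firing A \<or> (\<exists>q. k = Some (q, T, S0))}"
  define dl where "dl z a b c d =
    (delta A (fst z) (map_option fst a) (map_option fst b) (map_option fst c) (map_option fst d),
     kstep S0 T (snd z) (map_option snd a) (map_option snd b) (map_option snd c) (map_option snd d))"
    for z a b c d
  define ini where "ini b = (gen A (tau A b), kstart S0 b)" for b
  interpret P: automaton "(quiescent A, None)" ini dl \<Sigma> Fs
  proof
    show "finite \<Sigma>" using wf by (simp add: \<Sigma>_def \<Sigma>k_def S0_def nodes_def wf_fsa_def)
    show "(quiescent A, None) \<in> \<Sigma>" using wf by (simp add: \<Sigma>_def \<Sigma>k_def wf_fsa_def)
    show "ini b \<in> \<Sigma>" for b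
    proof -
      have "gen A (tau A b) \<in> states A" using wf by (rule wf_fsa_gen)
      then show ?thesis using origin by (auto simp: ini_def \<Sigma>_def \<Sigma>k_def kstart_def)
    qed
    show "Fs \<subseteq> \<Sigma>" by (auto simp: Fs_def)
    show "(quiescent A, None) \<notin> Fs" using wf by (simp add: Fs_def wf_fsa_def)
    show "dl z a b c d \<in> \<Sigma>"
      if z: "z \<in> \<Sigma>" and inp: "set_option a \<union> set_option b \<union> set_option c \<union> set_option d \<subseteq> \<Sigma>" for z a b c d
    proof -
      have "set_option (map_option fst a) \<union> set_option (map_option fst b) \<union>
          set_option (map_option fst c) \<union> set_option (map_option fst d) \<subseteq> states A"
        using inp by (auto simp: \<Sigma>_def)
      moreover have "fst z \<in> states A" using z by (auto simp: \<Sigma>_def)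
      ultimately have "fst (dl z a b c d) \<in> states A" using wf unfolding dl_def fst_conv
        by (intro wf_fsa_closed)
      moreover have "snd (dl z a b c d) \<in> \<Sigma>k"
      proof -
        let ?a = "map_option snd a" and ?b = "map_option snd b"
          and ?c = "map_option snd c" and ?d = "map_option snd d"
        have "K \<subseteq> S0" if known: "Some (Some (q, t, K)) \<in> {?a, ?b, ?c, ?d}" for q t K
        proof -
          obtain e where e: "e \<in> {a, b, c, d}" "map_option snd e = Some (Some (q, t, K))"
            using known by (metis insert_iff empty_iff)
          then have "set_option e \<subseteq> \<Sigma>" using inp by blast
          then show ?thesis using e(2) by (auto simp: \<Sigma>_def \<Sigma>k_def)
        qed
        then have h: "heard {?a, ?b, ?c, ?d} \<subseteq> S0" unfolding heard_def by blast
        show ?thesis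
        proof (cases "snd z")
          case None
          show ?thesis
          proof (cases "wake S0 T ?a ?b ?c ?d = {}")
            case True
            then show ?thesis using None by (simp add: dl_def kstep_None \<Sigma>k_def)
          next
            case False
            then obtain q1 t1 where W: "(q1, t1) \<in> wake S0 T ?a ?b ?c ?d" and
                "snd (dl z a b c d) = Some (q1, Suc t1, insert q1 (heard {?a, ?b, ?c, ?d}))"
              using kstep_None(2)[OF False] unfolding dl_def None snd_conv by force
            then show ?thesis using W h by (auto simp: wake_def \<Sigma>k_def)
          qed
        next
          case (Some x)
          then show ?thesis
            using z h by (cases "fst (snd x) < T") (auto simp: dl_def kstep_def \<Sigma>_def \<Sigma>k_def)
        qed
      qed
      ultimately show ?thesis by (simp add: \<Sigma>_def mem_Times_iff)
    qed
    show "dl (quiescent A, None) a b c d = (quiescent A, None)"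
      if inp: "{a, b, c, d} \<subseteq> {Some (quiescent A, None), None}" for a b c d
    proof -
      have f: "{map_option fst a, map_option fst b, map_option fst c, map_option fst d}
          \<subseteq> {Some (quiescent A), None}"
        and k: "{map_option snd a, map_option snd b, map_option snd c, map_option snd d} \<subseteq> {Some None, None}"
        using inp by auto
      have "wake S0 T (map_option snd a) (map_option snd b) (map_option snd c) (map_option snd d) = {}"
        using k unfolding wake_def by auto
      moreover note wf_fsa_quiet[OF wf f]
      ultimately show ?thesis by (simp add: dl_def kstep_None)
    qed
  qed
  have ini: "fst (ini b) = gen A (tau A b)" "snd (ini b) = kstart S0 b" for b
    by (simp_all add: ini_def)
  have dl: "fst (dl z a b c d) =
      delta A (fst z) (map_option fst a) (map_option fst b) (map_option fst c) (map_option fst d)"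
    "snd (dl z a b c d) =
      kstep S0 T (snd z) (map_option snd a) (map_option snd b) (map_option snd c) (map_option snd d)"
    for z a b c d by (simp_all add: dl_def)
  have run: "P.arun S t q = (run A S t q, krun S0 T S t q)" for S t q
  proof (induction t arbitrary: q)
    case 0
    then show ?case by (simp add: ini prod_eq_iff)
  next
    case (Suc t)
    have "map_option fst (sees S (P.arun S t) q d) = nbr S (run A S t) q d"
      "map_option snd (sees S (P.arun S t) q d) = sees S (krun S0 T S t) q d" for d
      using Suc by (simp_all add: sees_def nbr_def)
    then show ?case using Suc by (simp add: dl prod_eq_iff)
  qed
  have Fs: "P.arun S t q \<in> Fs \<longleftrightarrow> run A S t q \<in> firing A \<or> (\<exists>q'. krun S0 T S t q = Some (q', T, S0))"
    for S t q using P.arun_state[of S t q] unfolding run Fs_def by auto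
  \<comment> \<open>By soundness and rigidity, a single node with full knowledge already certifies
    the whole configuration.\<close>
  have late: "t = T \<and> nodes r' s' p' = S0"
    if path': "path r' s' p'" and q: "q \<in> nodes r' s' p'"
      "krun S0 T (nodes r' s' p') t q = Some (q', T, S0)" for r' s' p' t q q'
  proof -
    have *: "t = T" "S0 \<subseteq> {v \<in> nodes r' s' p' \<inter> S0. bc (nodes r' s' p') v = bc S0 v}"
      using krun_sound[OF origin q] by simp_all
    then show ?thesis using path_rigid[OF path' origin] by blast
  qed
  have other: "P.afires (nodes r' s' p') t"
    if "path r' s' p'" "nodes r' s' p' \<noteq> S0" "fires_at A (nodes r' s' p') t" for r' s' p' t
    using that late[OF that(1)] Fs unfolding P.afires_def fires_at_def by meson
  have target: "P.afires S0 (min t T)" if t: "fires_at A S0 t" for t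
  proof -
    have "P.arun S0 u q \<notin> Fs" if "u < min t T" "q \<in> S0" for u q
    proof -
      have "run A S0 u q \<notin> firing A" using t that by (simp add: fires_at_def)
      moreover have "krun S0 T S0 u q \<noteq> Some (q', T, S0)" for q'
        using late[OF path, folded S0_def, of q u q'] that by auto
      ultimately show ?thesis using Fs by blast
    qed
    moreover have "P.arun S0 (min t T) q \<in> Fs" if q: "q \<in> S0" for q
    proof (cases "t \<le> T")
      case True
      then show ?thesis using t q Fs by (simp add: fires_at_def)
    next
      case False
      obtain i where i: "i \<in> {r..s}" "q = p i" using q by (auto simp: S0_def nodes_def)
      have "\<bar>i\<bar> \<le> int T" using T[OF i(1), of i] i(1) by simp
      then obtain K where K: "krun S0 T S0 T q = Some (q, T, K)" "\<forall>j\<in>{r..s}. p j \<in> K"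
        using krun_complete[OF path S0_def i(1), of T T] T[OF i(1)] i(2) by auto
      then have "S0 \<subseteq> K" by (auto simp: S0_def nodes_def)
      moreover have "K \<subseteq> S0" using krun_sound[OF origin q K(1)] by blast
      ultimately show ?thesis using K False Fs by simp
    qed
    ultimately show ?thesis unfolding P.afires_def by blast
  qed
  obtain B where B: "wf_fsa B" "\<And>S t. fires_at B S t \<longleftrightarrow> P.afires S t" using P.realise by blast
  have "\<exists>t. fires_at B (nodes r' s' p') t" if "path r' s' p'" for r' s' p'
  proof -
    obtain t where "fires_at A (nodes r' s' p') t"
      using A \<open>path r' s' p'\<close> unfolding is_solution_def is_config_iff_path by blast
    then show ?thesis using other[OF \<open>path r' s' p'\<close>] target B by metis
  qed
  then have "is_solution B" using B by (simp add: is_solution_def is_config_iff_path)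
  moreover obtain t where "fires_at A S0 t"
    using A path unfolding is_solution_def is_config_iff_path S0_def by blast
  ultimately show ?thesis using target B unfolding S0_def by (metis min.cobounded2)
qed

lemma fires_at_unique:
  assumes "fires_at A S t" "fires_at A S u" "q \<in> S"
  shows "t = u"
  using assms unfolding fires_at_def by (meson nat_neq_iff)

theorem theorem10:
  fixes r s :: int and p :: "int \<Rightarrow> int \<times> int"
  assumes "is_config r s p"
    and "type_II r s p"
    and "left_free r s p"
    and "-r \<ge> s"
  shows "int (mft r s p) = -2*r + s"
proof -
  have path: "path r s p" using assms(1) by (simp add: is_config_iff_path)
  \<comment> \<open>For \<open>s = 0\<close> the right hand would be free as well, contrary to Type
    II.\<close>
  have s: "0 < s" using assms path by (auto simp: type_II_def right_free_def path_def)
  then have r: "r < 0" using assms(4) by simp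
  have free: "fW r s p (r + 1) s = \<infinity>" using assms(3) r by (simp add: left_free_def)
  let ?S = "nodes r s p"
  have p0: "(0, 0) \<in> ?S" using path by (force simp: path_def nodes_def)
  have ft: "ft r s p A = t" if "fires_at A ?S t" for A t
    using that fires_at_unique[OF _ _ p0] unfolding ft_def by blast
  have lower: "- 2 * r + s \<le> int (ft r s p A)" if A: "is_solution A" for A
  proof -
    obtain t where t: "fires_at A ?S t" using A assms(1) unfolding is_solution_def by blast
    then show ?thesis using firing_time_lower_bound[OF A path r s free t] ft by simp
  qed
  obtain A t where A: "is_solution A" "fires_at A ?S t" "t \<le> nat (- 2 * r + s)"
  proof -
    \<comment> \<open>The extreme cases are \<open>j = r\<close>, \<open>i = s\<close> with value
      \<open>s - 2 * r\<close>, and \<open>j = s\<close>, \<open>i = r\<close> with value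
      \<open>2 * s - r\<close>; the first is the larger as \<open>s \<le> - r\<close>.\<close>
    have "\<bar>j\<bar> + \<bar>i - j\<bar> \<le> int (nat (- 2 * r + s))" if "i \<in> {r..s}" "j \<in> {r..s}" for i j
      using that assms(4) r s by auto
    then show ?thesis using firing_time_upper_bound[OF path] that by blast
  qed
  then have "int (ft r s p A) = - 2 * r + s" using lower[OF A(1)] ft r s by simp
  moreover have "mft r s p = ft r s p A"
    unfolding mft_def
  proof (rule Least_equality)
    show "\<exists>B. is_solution B \<and> ft r s p B = ft r s p A" using A by blast
    show "ft r s p A \<le> n" if "\<exists>B. is_solution B \<and> ft r s p B = n" for n
      using that lower \<open>int (ft r s p A) = - 2 * r + s\<close> by fastforce
  qed
  ultimately show ?thesis by simp
qed

end
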